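(* Let $(A,\succ_A,\prec_A)$ and $(A^*,\succ_{A^*},\prec_{A^*})$ be special type-$a$ pre-Leibniz algebras with sub-adjacent Leibniz algebras $(A,\circ_A)$ and $(A^*,\circ_{A^*})$ respectively. Then the following conditions are equivalent: (a) $(A,\succ_A,\prec_A,\vartheta,\theta)$ is a special type-$a$ pre-Leibniz bialgebra, where $\vartheta,\theta:A\to A\otimes A$ are the linear duals of $\succ_{A^*}$ and $\prec_{A^*}$ respectively. (b) There is a Manin triple $\big((A\oplus A^*,\circ_d,\mathcal{B}_d),(A,\circ_A),(A^*,\circ_{A^*})\big)$ of Leibniz algebras associated to the nondegenerate symmetric left-invariant bilinear form $\mathcal{B}_d$ such that the compatible special type-$a$ pre-Leibniz algebra $(A\oplus A^*,\succ_d,\prec_d)$ induced from $\mathcal{B}_d$ contains $(A,\succ_A,\prec_A)$ and $(A^*,\succ_{A^*},\prec_{A^*})$ as subalgebras. (c) There is a Manin triple $\big((A\oplus A^*,\succ_d,\prec_d,\mathcal{B}_d),(A,\succ_A,\prec_A),(A^*,\succ_{A^*},\prec_{A^*})\big)$ of special type-$a$ pre-Leibniz algebras. (d) There is a Leibniz algebra $(A\oplus A^*,\circ_d)$ with $\circ_d$ defined, for all $x,y\in A$, $a^*,b^*\in A^*$, by $$(x+a^* )\circ_d(y+b^* )=x\circ_A y+L^*_{\circ_{A^*}}(a^* )y-L^*_{\prec_{A^*}}(b^* )x+a^*\circ_{A^*}b^*+L^*_{\circ_A}(x)b^*-L^*_{\prec_A}(y)a^*.$$ (e) There is a special type-$a$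 pre-Leibniz algebra $(A\oplus A^*,\succ_d,\prec_d)$ with $\succ_d,\prec_d$ defined, for all $x,y\in A$, $a^*,b^*\in A^*$, by $$(x+a^* )\succ_d(y+b^* )=x\succ_A y+(L^*_{\succ_{A^*}}+R^*_{\succ_{A^*}})(a^* )y-R^*_{\succ_{A^*}}(b^* )x+a^*\succ_{A^*}b^*+(L^*_{\succ_A}+R^*_{\succ_A})(x)b^*-R^*_{\succ_A}(y)a^*,$$ $$(x+a^* )\prec_d(y+b^* )=x\prec_A y-R^*_{\circ_{A^*}}(a^* )y+R^*_{\circ_{A^*}}(b^* )x+a^*\prec_{A^*}b^*-R^*_{\circ_A}(x)b^*+R^*_{\circ_A}(y)a^*.$$
   Context: All vector spaces are finite-dimensional over an algebraically closed field $\mathbb{K}$ of characteristic zero. For a multiplication $\ast$ on a space $A$, $L_\ast(x)y=x\ast y$ and $R_\ast(x)y=y\ast x$. For a linear map $\rho:A\to\mathrm{End}_{\mathbb{K}}(V)$, $\rho^*:A\to\mathrm{End}_{\mathbb{K}}(V^* )$ is defined by $\langle\rho^*(x)u^*,v\rangle=-\langle u^*,\rho(x)v\rangle$; for multiplications on $A^*$ one identifies $A^{**}=A$. $\tau$ is the flip $\tau(x\otimes y)=y\otimes x$. A Leibniz algebra: a bilinear multiplication with $x\circ_A(y\circ_A z)=(x\circ_A y)\circ_A z+y\circ_A(x\circ_A z)$. A bilinear form $\mathcal{B}$ on it is left-invariant if $\mathcal{B}(x\circ_A y,z)+\mathcal{B}(y,x\circ_A z)=0$. A special type-$a$ pre-Leibniz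 algebra (with $a=\begin{pmatrix}1&-1\\-1&0\end{pmatrix}$): a vector space $A$ with bilinear multiplications $\succ_A,\prec_A$ such that $\prec_A$ is anticommutative, $(A,\circ_A)$ with $x\circ_A y:=x\succ_A y+x\prec_A y$ is a Leibniz algebra (the sub-adjacent Leibniz algebra; the structure is called compatible on it), and $x\circ_A(y\prec_A z)=(x\circ_A y)\prec_A z+y\prec_A(x\circ_A z)=x\prec_A(y\prec_A z)$ for all $x,y,z\in A$. A symmetric bilinear form $\mathcal{B}$ on it is invariant if $\mathcal{B}(x\prec_A y,z)=-\mathcal{B}(x,z\circ_A y)$; it is quadratic when equipped with a nondegenerate symmetric invariant bilinear form. A nondegenerate symmetric left-invariant form $\mathcal{B}$ on a Leibniz algebra $(A,\circ_A)$ induces a compatible special type-$a$ pre-Leibniz algebra by $\mathcal{B}(x\succ_A y,z)=-\mathcal{B}(y,x\circ_A z+z\circ_A x)$, $\mathcal{B}(x\prec_A y,z)=-\mathcal{B}(x,z\circ_A y)$. A special type-$a$ pre-Leibniz coalgebra $(A,\vartheta,\theta)$: linear maps $\vartheta,\theta:A\to A\otimes A$ such that, with $\eta=\vartheta+\theta$, for all $x\in A$: $(\eta\otimes\mathrm{id})\eta(x)+(\tau\otimes\mathrm{id})(\mathrm{id}\otimes\eta)\eta(x)-(\mathrm{id}\otimes\eta)\eta(x)=0$; $\theta(x)=-\tau\theta(x)$; $(\mathrm{id}\otimes\theta)\eta(x)=(\eta\otimes\mathrm{id})\theta(x)+(\tau\otimes\mathrm{id})(\mathrm{id}\otimes\eta)\theta(x)$;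 $(\mathrm{id}\otimes\theta)\vartheta(x)=0$. A special type-$a$ pre-Leibniz bialgebra $(A,\succ_A,\prec_A,\vartheta,\theta)$: $(A,\succ_A,\prec_A)$ is a special type-$a$ pre-Leibniz algebra, $(A,\vartheta,\theta)$ is a special type-$a$ pre-Leibniz coalgebra, and for all $x,y\in A$ (with $\eta=\vartheta+\theta$): $$\eta(x\prec_A y)=(\mathrm{id}\otimes\mathrm{id}-\tau)\big(\mathrm{id}\otimes L_{\prec_A}(x)\big)\eta(y)+(\mathrm{id}\otimes\mathrm{id}-\tau)\big(\mathrm{id}\otimes R_{\prec_A}(y)\big)\eta(x),$$ $$\big(L_{\circ_A}(x)\otimes\mathrm{id}\big)\eta(y)=\big(L_{\prec_A}(x)\otimes\mathrm{id}\big)\eta(y)+\big(\mathrm{id}\otimes R_{\circ_A}(y)\big)\eta(x)-\big(\mathrm{id}\otimes R_{\circ_A}(y)\big)\theta(x),$$ $$\theta(x\circ_A y)=\big(\mathrm{id}\otimes L_{\circ_A}(x)+L_{\circ_A}(x)\otimes\mathrm{id}\big)\theta(y)-\big(\mathrm{id}\otimes L_{\circ_A}(y)+L_{\circ_A}(y)\otimes\mathrm{id}\big)\theta(x),$$ $$\eta(x\circ_A y)=\big(\mathrm{id}\otimes R_{\circ_A}(y)\big)\eta(x)+\big(\mathrm{id}\otimes L_{\circ_A}(x)+L_{\prec_A}(x)\otimes\mathrm{id}\big)\eta(y)-\big(L_{\prec_A}(y)\otimes\mathrm{id}\big)\theta(x).$$ The linear duals $\vartheta,\theta:A\to A\otimes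 A$ of $\succ_{A^*},\prec_{A^*}$ are defined by $\langle\vartheta(x),a^*\otimes b^*\rangle=\langle x,a^*\succ_{A^*}b^*\rangle$ and $\langle\theta(x),a^*\otimes b^*\rangle=\langle x,a^*\prec_{A^*}b^*\rangle$. On $A\oplus A^*$ let $\mathcal{B}_d(x+a^*,y+b^* )=\langle x,b^*\rangle+\langle a^*,y\rangle$. A Manin triple of Leibniz algebras associated to the nondegenerate symmetric left-invariant bilinear form $\mathcal{B}_d$ is a triple $\big((A\oplus A^*,\circ_d,\mathcal{B}_d),(A,\circ_A),(A^*,\circ_{A^*})\big)$ where $(A\oplus A^*,\circ_d)$ is a Leibniz algebra containing $(A,\circ_A)$ and $(A^*,\circ_{A^*})$ as Leibniz subalgebras and $\mathcal{B}_d$ is left-invariant on $(A\oplus A^*,\circ_d)$. A Manin triple of special type-$a$ pre-Leibniz algebras is a triple $\big((A\oplus A^*,\succ_d,\prec_d,\mathcal{B}_d),(A,\succ_A,\prec_A),(A^*,\succ_{A^*},\prec_{A^*})\big)$ where $(A\oplus A^*,\succ_d,\prec_d,\mathcal{B}_d)$ is a quadratic special type-$a$ pre-Leibniz algebra containing $(A,\succ_A,\prec_A)$ and $(A^*,\succ_{A^*},\prec_{A^*})$ as subalgebras. *)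

theory Defs
  imports
    "HOL-Library.Function_Algebras"
    "HOL-Library.Product_Plus"
    "HOL-Computational_Algebra.Computational_Algebra"
begin

text \<open>
  A vector space is a subspace \<open>S\<close> of a type on which \<open>vector_space s\<close> holds. For the space \<open>A\<close>
  itself \<open>S = UNIV\<close>; the dual space is a subspace of the function type \<open>'a \<Rightarrow> 'k\<close>, and
  \<open>A \<oplus> A\<^sup>*\<close> is \<open>UNIV \<times> dual s\<close>. The additive structure on functions and pairs is pointwise.
  Multiplications are total functions on the ambient type; only their values on \<open>S\<close> matter.
\<close>

section \<open>Dual space, direct sum, dual representations\<close>

definition fscale :: "'k::field \<Rightarrow> ('x \<Rightarrow> 'k) \<Rightarrow> ('x \<Rightarrow> 'k)" where
  "fscale c f = (\<lambda>x. c * f x)"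

definition dual :: "('k::field \<Rightarrow> 'a::ab_group_add \<Rightarrow> 'a) \<Rightarrow> ('a \<Rightarrow> 'k) set" where
  "dual s = {f. Vector_Spaces.linear s (*) f}"

definition dscale :: "('k::field \<Rightarrow> 'a \<Rightarrow> 'a) \<Rightarrow> 'k \<Rightarrow> 'a \<times> ('a \<Rightarrow> 'k) \<Rightarrow> 'a \<times> ('a \<Rightarrow> 'k)" where
  "dscale s c p = (s c (fst p), fscale c (snd p))"

definition dsum :: "('k::field \<Rightarrow> 'a::ab_group_add \<Rightarrow> 'a) \<Rightarrow> ('a \<times> ('a \<Rightarrow> 'k)) set" where
  "dsum s = UNIV \<times> dual s"

definition Lmul :: "('v \<Rightarrow> 'v \<Rightarrow> 'v) \<Rightarrow> 'v \<Rightarrow> 'v \<Rightarrow> 'v" where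
  "Lmul m x y = m x y"

definition Rmul :: "('v \<Rightarrow> 'v \<Rightarrow> 'v) \<Rightarrow> 'v \<Rightarrow> 'v \<Rightarrow> 'v" where
  "Rmul m x y = m y x"

definition dual_rep :: "('x \<Rightarrow> 'v \<Rightarrow> 'v) \<Rightarrow> 'x \<Rightarrow> ('v \<Rightarrow> 'k::field) \<Rightarrow> ('v \<Rightarrow> 'k)" where
  "dual_rep \<rho> x u = (\<lambda>v. - u (\<rho> x v))"

text \<open>
  The identification of \<open>A\<^sup>*\<^sup>*\<close> with \<open>A\<close>: the functional \<open>\<phi>\<close> on the dual space corresponds to the
  vector \<open>z\<close> with \<open>\<phi> = (\<lambda>f. f z)\<close>.
\<close>

definition from_bidual ::
  "('k::field \<Rightarrow> 'a::ab_group_add \<Rightarrow> 'a) \<Rightarrow> (('a \<Rightarrow> 'k) \<Rightarrow> 'k) \<Rightarrow> 'a" where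
  "from_bidual s \<phi> = (THE z. \<forall>f\<in>dual s. \<phi> f = f z)"

text \<open>For \<open>\<rho> : A\<^sup>* \<rightarrow> End(A\<^sup>*)\<close>, the dual map \<open>\<rho>\<^sup>*\<close> viewed as a map \<open>A\<^sup>* \<rightarrow> End(A)\<close>.\<close>

definition dual_rep' ::
  "('k::field \<Rightarrow> 'a::ab_group_add \<Rightarrow> 'a) \<Rightarrow> (('a \<Rightarrow> 'k) \<Rightarrow> ('a \<Rightarrow> 'k) \<Rightarrow> ('a \<Rightarrow> 'k))
    \<Rightarrow> ('a \<Rightarrow> 'k) \<Rightarrow> 'a \<Rightarrow> 'a" where
  "dual_rep' s \<rho> a y = from_bidual s (dual_rep \<rho> a (\<lambda>f. f y))"


section \<open>Leibniz algebras and special pre-Leibniz algebras\<close>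

definition bilinear_mult ::
  "('k::field \<Rightarrow> 'v::ab_group_add \<Rightarrow> 'v) \<Rightarrow> 'v set \<Rightarrow> ('v \<Rightarrow> 'v \<Rightarrow> 'v) \<Rightarrow> bool" where
  "bilinear_mult s S m \<longleftrightarrow>
     vector_space s \<and> module.subspace s S \<and>
     (\<forall>x\<in>S. \<forall>y\<in>S. m x y \<in> S) \<and>
     (\<forall>x\<in>S. \<forall>y\<in>S. \<forall>z\<in>S. m (x + y) z = m x z + m y z \<and> m x (y + z) = m x y + m x z) \<and>
     (\<forall>c. \<forall>x\<in>S. \<forall>y\<in>S. m (s c x) y = s c (m x y) \<and> m x (s c y) = s c (m x y))"

definition leibniz_algebra ::
  "('k::field \<Rightarrow> 'v::ab_group_add \<Rightarrow> 'v) \<Rightarrow> 'v set \<Rightarrow> ('v \<Rightarrow> 'v \<Rightarrow> 'v) \<Rightarrow> bool" where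
  "leibniz_algebra s S circ \<longleftrightarrow>
     bilinear_mult s S circ \<and>
     (\<forall>x\<in>S. \<forall>y\<in>S. \<forall>z\<in>S. circ x (circ y z) = circ (circ x y) z + circ y (circ x z))"

definition sub_adjacent ::
  "('v \<Rightarrow> 'v \<Rightarrow> 'v::ab_group_add) \<Rightarrow> ('v \<Rightarrow> 'v \<Rightarrow> 'v) \<Rightarrow> 'v \<Rightarrow> 'v \<Rightarrow> 'v" where
  "sub_adjacent succ prec x y = succ x y + prec x y"

definition special_pre_leibniz_algebra ::
  "('k::field \<Rightarrow> 'v::ab_group_add \<Rightarrow> 'v) \<Rightarrow> 'v set \<Rightarrow> ('v \<Rightarrow> 'v \<Rightarrow> 'v) \<Rightarrow> ('v \<Rightarrow> 'v \<Rightarrow> 'v) \<Rightarrow> bool"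
  where
  "special_pre_leibniz_algebra s S succ prec \<longleftrightarrow>
     (let circ = sub_adjacent succ prec in
        bilinear_mult s S succ \<and> bilinear_mult s S prec \<and>
        (\<forall>x\<in>S. \<forall>y\<in>S. prec x y = - prec y x) \<and>
        leibniz_algebra s S circ \<and>
        (\<forall>x\<in>S. \<forall>y\<in>S. \<forall>z\<in>S.
           circ x (prec y z) = prec (circ x y) z + prec y (circ x z) \<and>
           circ x (prec y z) = prec x (prec y z)))"

definition compatible_on ::
  "('k::field \<Rightarrow> 'v::ab_group_add \<Rightarrow> 'v) \<Rightarrow> 'v set \<Rightarrow> ('v \<Rightarrow> 'v \<Rightarrow> 'v)
     \<Rightarrow> ('v \<Rightarrow> 'v \<Rightarrow> 'v) \<Rightarrow> ('v \<Rightarrow> 'v \<Rightarrow> 'v) \<Rightarrow> bool" where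
  "compatible_on s S circ succ prec \<longleftrightarrow>
     special_pre_leibniz_algebra s S succ prec \<and>
     (\<forall>x\<in>S. \<forall>y\<in>S. sub_adjacent succ prec x y = circ x y)"


section \<open>Bilinear forms\<close>

definition nondeg_sym_form ::
  "('k::field \<Rightarrow> 'v::ab_group_add \<Rightarrow> 'v) \<Rightarrow> 'v set \<Rightarrow> ('v \<Rightarrow> 'v \<Rightarrow> 'k) \<Rightarrow> bool" where
  "nondeg_sym_form s S B \<longleftrightarrow>
     (\<forall>x\<in>S. \<forall>y\<in>S. \<forall>z\<in>S. B (x + y) z = B x z + B y z \<and> B x (y + z) = B x y + B x z) \<and>
     (\<forall>c. \<forall>x\<in>S. \<forall>y\<in>S. B (s c x) y = c * B x y \<and> B x (s c y) = c * B x y) \<and>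
     (\<forall>x\<in>S. \<forall>y\<in>S. B x y = B y x) \<and>
     (\<forall>x\<in>S. (\<forall>y\<in>S. B x y = 0) \<longrightarrow> x = 0)"

definition left_invariant ::
  "'v set \<Rightarrow> ('v \<Rightarrow> 'v \<Rightarrow> 'v) \<Rightarrow> ('v \<Rightarrow> 'v \<Rightarrow> 'k::field) \<Rightarrow> bool" where
  "left_invariant S circ B \<longleftrightarrow>
     (\<forall>x\<in>S. \<forall>y\<in>S. \<forall>z\<in>S. B (circ x y) z + B y (circ x z) = 0)"

definition quadratic_special_pre_leibniz_algebra ::
  "('k::field \<Rightarrow> 'v::ab_group_add \<Rightarrow> 'v) \<Rightarrow> 'v set \<Rightarrow> ('v \<Rightarrow> 'v \<Rightarrow> 'v) \<Rightarrow> ('v \<Rightarrow> 'v \<Rightarrow> 'v)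
     \<Rightarrow> ('v \<Rightarrow> 'v \<Rightarrow> 'k) \<Rightarrow> bool" where
  "quadratic_special_pre_leibniz_algebra s S succ prec B \<longleftrightarrow>
     special_pre_leibniz_algebra s S succ prec \<and> nondeg_sym_form s S B \<and>
     (\<forall>x\<in>S. \<forall>y\<in>S. \<forall>z\<in>S. B (prec x y) z = - B x (sub_adjacent succ prec z y))"

text \<open>The multiplications induced on a Leibniz algebra by a nondegenerate form.\<close>

definition induced_succ ::
  "'v set \<Rightarrow> ('v \<Rightarrow> 'v \<Rightarrow> 'k::field) \<Rightarrow> ('v \<Rightarrow> 'v \<Rightarrow> 'v) \<Rightarrow> 'v \<Rightarrow> 'v \<Rightarrow> 'v::ab_group_add" where
  "induced_succ S B circ x y =
     (THE w. w \<in> S \<and> (\<forall>z\<in>S. B w z = - B y (circ x z + circ z x)))"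

definition induced_prec ::
  "'v set \<Rightarrow> ('v \<Rightarrow> 'v \<Rightarrow> 'k::field) \<Rightarrow> ('v \<Rightarrow> 'v \<Rightarrow> 'v) \<Rightarrow> 'v \<Rightarrow> 'v \<Rightarrow> 'v::ab_group_add" where
  "induced_prec S B circ x y = (THE w. w \<in> S \<and> (\<forall>z\<in>S. B w z = - B x (circ z y)))"


section \<open>Tensors\<close>

text \<open>
  \<open>A \<otimes> A\<close> is realised as the span of the pure tensors \<open>x \<otimes> y\<close> inside the functions on
  \<open>A\<^sup>* \<times> A\<^sup>*\<close>, where \<open>x \<otimes> y\<close> is \<open>(a, b) \<mapsto> a(x) b(y)\<close>. Hence the value \<open>t a b\<close> is
  the pairing of the tensor \<open>t\<close> with \<open>a \<otimes> b\<close>. Likewise elements of \<open>A \<otimes> A \<otimes> A\<close> are functions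
  of three functionals. All these functions are set to \<open>0\<close> outside the dual space, so that
  equality of tensors is equality of functions.
\<close>

type_synonym ('a, 'k) tensor2 = "('a \<Rightarrow> 'k) \<Rightarrow> ('a \<Rightarrow> 'k) \<Rightarrow> 'k"
type_synonym ('a, 'k) tensor3 = "('a \<Rightarrow> 'k) \<Rightarrow> ('a \<Rightarrow> 'k) \<Rightarrow> ('a \<Rightarrow> 'k) \<Rightarrow> 'k"

definition restrict2 ::
  "('k::field \<Rightarrow> 'a::ab_group_add \<Rightarrow> 'a) \<Rightarrow> ('a, 'k) tensor2 \<Rightarrow> ('a, 'k) tensor2" where
  "restrict2 s h = (\<lambda>a b. if a \<in> dual s \<and> b \<in> dual s then h a b else 0)"

definition restrict3 ::
  "('k::field \<Rightarrow> 'a::ab_group_add \<Rightarrow> 'a) \<Rightarrow> ('a, 'k) tensor3 \<Rightarrow> ('a, 'k) tensor3" where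
  "restrict3 s h = (\<lambda>a b c. if a \<in> dual s \<and> b \<in> dual s \<and> c \<in> dual s then h a b c else 0)"

definition tscale :: "'k::field \<Rightarrow> ('a, 'k) tensor2 \<Rightarrow> ('a, 'k) tensor2" where
  "tscale c t = (\<lambda>a b. c * t a b)"

definition pure_tensor ::
  "('k::field \<Rightarrow> 'a::ab_group_add \<Rightarrow> 'a) \<Rightarrow> 'a \<Rightarrow> 'a \<Rightarrow> ('a, 'k) tensor2" where
  "pure_tensor s x y = restrict2 s (\<lambda>a b. a x * b y)"

definition tensor_space ::
  "('k::field \<Rightarrow> 'a::ab_group_add \<Rightarrow> 'a) \<Rightarrow> ('a, 'k) tensor2 set" where
  "tensor_space s = module.span tscale (range (\<lambda>(x, y). pure_tensor s x y))"

definition flip :: "('a, 'k) tensor2 \<Rightarrow> ('a, 'k) tensor2" where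
  "flip t = (\<lambda>a b. t b a)"

text \<open>\<open>f \<otimes> g\<close> on \<open>A \<otimes> A\<close>, for endomorphisms \<open>f\<close>, \<open>g\<close> of \<open>A\<close>.\<close>

definition tensor_map ::
  "('k::field \<Rightarrow> 'a::ab_group_add \<Rightarrow> 'a) \<Rightarrow> ('a \<Rightarrow> 'a) \<Rightarrow> ('a \<Rightarrow> 'a)
     \<Rightarrow> ('a, 'k) tensor2 \<Rightarrow> ('a, 'k) tensor2" where
  "tensor_map s f g t = restrict2 s (\<lambda>a b. t (a \<circ> f) (b \<circ> g))"

text \<open>
  \<open>\<delta> \<otimes> id\<close>, \<open>id \<otimes> \<delta>\<close> from \<open>A \<otimes> A\<close> to \<open>A \<otimes> A \<otimes> A\<close> for \<open>\<delta> : A \<rightarrow> A \<otimes> A\<close>, and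
  \<open>\<tau> \<otimes> id\<close> on \<open>A \<otimes> A \<otimes> A\<close>.
\<close>

definition comul_id ::
  "('k::field \<Rightarrow> 'a::ab_group_add \<Rightarrow> 'a) \<Rightarrow> ('a \<Rightarrow> ('a, 'k) tensor2)
     \<Rightarrow> ('a, 'k) tensor2 \<Rightarrow> ('a, 'k) tensor3" where
  "comul_id s \<delta> t = restrict3 s (\<lambda>a b c. t (\<lambda>x. \<delta> x a b) c)"

definition id_comul ::
  "('k::field \<Rightarrow> 'a::ab_group_add \<Rightarrow> 'a) \<Rightarrow> ('a \<Rightarrow> ('a, 'k) tensor2)
     \<Rightarrow> ('a, 'k) tensor2 \<Rightarrow> ('a, 'k) tensor3" where
  "id_comul s \<delta> t = restrict3 s (\<lambda>a b c. t a (\<lambda>x. \<delta> x b c))"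

definition flip_id :: "('a, 'k) tensor3 \<Rightarrow> ('a, 'k) tensor3" where
  "flip_id T = (\<lambda>a b c. T b a c)"

text \<open>The linear dual \<open>A \<rightarrow> A \<otimes> A\<close> of a multiplication on the dual space.\<close>

definition linear_dual ::
  "('k::field \<Rightarrow> 'a::ab_group_add \<Rightarrow> 'a) \<Rightarrow> (('a \<Rightarrow> 'k) \<Rightarrow> ('a \<Rightarrow> 'k) \<Rightarrow> ('a \<Rightarrow> 'k))
     \<Rightarrow> 'a \<Rightarrow> ('a, 'k) tensor2" where
  "linear_dual s m x = restrict2 s (\<lambda>a b. m a b x)"

text \<open>
  The following facts confirm that these formulas are the usual ones: each operation has the
  expected effect on pure tensors, and for finite-dimensional \<open>A\<close> the functionals on \<open>A\<^sup>*\<close> are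
  evaluations and \<open>A \<otimes> A\<close> consists of all bilinear forms on \<open>A\<^sup>*\<close>, so that linear duals
  of bilinear multiplications take values in it.
\<close>

lemma sum_fun_apply: "(\<Sum>e\<in>E. g e) x = (\<Sum>e\<in>E. g e x)"
  by (induction E rule: infinite_finite_induct) auto

lemma dual_add: "f \<in> dual s \<Longrightarrow> f (x + y) = f x + f y"
  and dual_scale: "f \<in> dual s \<Longrightarrow> f (s c x) = c * f x"
  by (auto simp: dual_def linear_iff_module_hom module_hom.add module_hom.scale)

lemma pure_tensor_bilinear:
  "pure_tensor s (x + x') y = pure_tensor s x y + pure_tensor s x' y"
  "pure_tensor s x (y + y') = pure_tensor s x y + pure_tensor s x y'"
  "pure_tensor s (s c x) y = tscale c (pure_tensor s x y)"
  "pure_tensor s x (s c y) = tscale c (pure_tensor s x y)"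
  by (auto simp: pure_tensor_def restrict2_def tscale_def fun_eq_iff dual_add dual_scale
      algebra_simps)

lemma dual_comp:
  assumes "a \<in> dual s" "Vector_Spaces.linear s s f"
  shows "a \<circ> f \<in> dual s"
  using assms by (auto simp: dual_def intro: Vector_Spaces.linear_compose)

lemma tensor_map_pure:
  assumes "Vector_Spaces.linear s s f" "Vector_Spaces.linear s s g"
  shows "tensor_map s f g (pure_tensor s x y) = pure_tensor s (f x) (g y)"
  using dual_comp[OF _ assms(1)] dual_comp[OF _ assms(2)]
  by (auto simp: tensor_map_def pure_tensor_def restrict2_def fun_eq_iff)

lemma flip_pure: "flip (pure_tensor s x y) = pure_tensor s y x"
  by (auto simp: flip_def pure_tensor_def restrict2_def fun_eq_iff)

lemma vector_space_tscale: "vector_space tscale"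
  by unfold_locales (auto simp: tscale_def fun_eq_iff algebra_simps)

lemma vector_space_fscale: "vector_space fscale"
  by unfold_locales (auto simp: fscale_def fun_eq_iff algebra_simps)

lemma comul_pure:
  assumes "Vector_Spaces.linear s tscale \<delta>"
  shows "comul_id s \<delta> (pure_tensor s x y) = restrict3 s (\<lambda>a b c. \<delta> x a b * c y)"
    and "id_comul s \<delta> (pure_tensor s x y) = restrict3 s (\<lambda>a b c. a x * \<delta> y b c)"
proof -
  interpret module_hom s tscale \<delta>
    using assms by (simp add: linear_iff_module_hom)
  have "(\<lambda>x. \<delta> x a b) \<in> dual s" for a b
    unfolding dual_def mem_Collect_eq Vector_Spaces.linear_iff
    using assms by (auto simp: Vector_Spaces.linear_def add scale tscale_def
        intro!: vector_space.intro simp: algebra_simps)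
  then show "comul_id s \<delta> (pure_tensor s x y) = restrict3 s (\<lambda>a b c. \<delta> x a b * c y)"
    and "id_comul s \<delta> (pure_tensor s x y) = restrict3 s (\<lambda>a b c. a x * \<delta> y b c)"
    by (auto simp: comul_id_def id_comul_def pure_tensor_def restrict2_def restrict3_def
        fun_eq_iff)
qed

context finite_dimensional_vector_space
begin

lemma coord_dual: "e \<in> Basis \<Longrightarrow> (\<lambda>x. representation Basis x e) \<in> dual scale"
  unfolding dual_def mem_Collect_eq Vector_Spaces.linear_iff
  by (auto simp: representation_add representation_scale independent_Basis span_Basis
      vector_space_axioms intro!: vector_space.intro simp: algebra_simps)

lemma dual_expand:
  assumes "f \<in> dual scale"
  shows "f = (\<Sum>e\<in>Basis. fscale (f e) (\<lambda>x. representation Basis x e))"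
proof
  fix x
  interpret f: module_hom scale "(*)" f
    using assms by (simp add: dual_def linear_iff_module_hom)
  have "x = (\<Sum>e\<in>Basis. scale (representation Basis x e) e)"
    by (rule sum_representation_eq[symmetric])
      (auto simp: independent_Basis span_Basis finite_Basis)
  then have "f x = f (\<Sum>e\<in>Basis. scale (representation Basis x e) e)"
    by simp
  also have "\<dots> = (\<Sum>e\<in>Basis. f e * representation Basis x e)"
    by (simp add: f.sum f.scale mult.commute)
  also have "\<dots> = (\<Sum>e\<in>Basis. fscale (f e) (\<lambda>x. representation Basis x e)) x"
    by (simp add: sum_fun_apply fscale_def)
  finally show "f x = (\<Sum>e\<in>Basis. fscale (f e) (\<lambda>x. representation Basis x e)) x" .
qed

lemma subspace_dual: "module.subspace fscale (dual scale)"
proof -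
  interpret F: vector_space fscale by (rule vector_space_fscale)
  show ?thesis
    unfolding F.subspace_def dual_def mem_Collect_eq Vector_Spaces.linear_iff
    by (auto simp: fscale_def algebra_simps vector_space_axioms intro!: vector_space.intro)
qed

lemma functional_on_dual_expand:
  assumes add: "\<And>f g. f \<in> dual scale \<Longrightarrow> g \<in> dual scale \<Longrightarrow> \<phi> (f + g) = \<phi> f + \<phi> g"
    and scl: "\<And>c f. f \<in> dual scale \<Longrightarrow> \<phi> (fscale c f) = c * \<phi> f"
    and f: "f \<in> dual scale"
  shows "\<phi> f = (\<Sum>e\<in>Basis. f e * \<phi> (\<lambda>x. representation Basis x e))"
proof -
  interpret F: vector_space fscale by (rule vector_space_fscale)
  let ?c = "\<lambda>e x. representation Basis x e"
  note sub = subspace_dual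
  have "\<phi> 0 = 0"
    using scl[of 0 0] F.subspace_0[OF sub] by (simp add: F.scale_zero_left)
  have "\<phi> (\<Sum>e\<in>E. fscale (f e) (?c e)) = (\<Sum>e\<in>E. f e * \<phi> (?c e))" if "finite E" "E \<subseteq> Basis" for E
    using that
  proof (induction E rule: finite_induct)
    case empty
    then show ?case using \<open>\<phi> 0 = 0\<close> by (simp add: zero_fun_def)
  next
    case (insert e E)
    have "fscale (f e) (?c e) \<in> dual scale"
      using insert.prems coord_dual by (auto intro: F.subspace_scale[OF sub])
    moreover have "(\<Sum>e\<in>E. fscale (f e) (?c e)) \<in> dual scale"
      using insert.prems coord_dual by (auto intro!: F.subspace_sum[OF sub] F.subspace_scale[OF sub])
    ultimately show ?case
      using insert coord_dual[of e] by (simp add: add scl del: plus_fun_apply)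
  qed
  from this[OF finite_Basis order_refl] dual_expand[OF f] show ?thesis by simp
qed

lemma from_bidual_eq:
  assumes "\<And>f g. f \<in> dual scale \<Longrightarrow> g \<in> dual scale \<Longrightarrow> \<phi> (f + g) = \<phi> f + \<phi> g"
    and "\<And>c f. f \<in> dual scale \<Longrightarrow> \<phi> (fscale c f) = c * \<phi> f"
    and f: "f \<in> dual scale"
  shows "f (from_bidual scale \<phi>) = \<phi> f"
proof -
  let ?z = "\<Sum>e\<in>Basis. scale (\<phi> (\<lambda>x. representation Basis x e)) e"
  have z: "\<phi> g = g ?z" if g: "g \<in> dual scale" for g
  proof -
    interpret g: module_hom scale "(*)" g
      using g by (simp add: dual_def linear_iff_module_hom)
    show ?thesis
      using functional_on_dual_expand[of \<phi>, OF assms(1,2) g]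
      by (simp add: g.sum g.scale mult.commute)
  qed
  have "from_bidual scale \<phi> = ?z"
    unfolding from_bidual_def
  proof (rule the_equality)
    fix w assume w: "\<forall>f\<in>dual scale. \<phi> f = f w"
    have "representation Basis w e = representation Basis ?z e" if "e \<in> Basis" for e
      using w z coord_dual[OF that] by metis
    then have "(\<Sum>e\<in>Basis. scale (representation Basis w e) e)
        = (\<Sum>e\<in>Basis. scale (representation Basis ?z e) e)"
      by simp
    moreover have "(\<Sum>e\<in>Basis. scale (representation Basis v e) e) = v" for v
      by (rule sum_representation_eq) (auto simp: independent_Basis span_Basis finite_Basis)
    ultimately show "w = ?z" by metis
  qed (use z in auto)
  then show ?thesis using z[OF f] by simp
qed

lemma linear_dual_in_tensor_space:
  assumes m: "bilinear_mult fscale (dual scale) m"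
  shows "linear_dual scale m x \<in> tensor_space scale"
proof -
  interpret T: vector_space tscale by (rule vector_space_tscale)
  let ?c = "\<lambda>e x. representation Basis x e"
  let ?u = "\<Sum>e\<in>Basis. \<Sum>e'\<in>Basis. tscale (m (?c e) (?c e') x) (pure_tensor scale e e')"
  have "linear_dual scale m x a b = ?u a b" for a b
  proof (cases "a \<in> dual scale \<and> b \<in> dual scale")
    case True
    then have a: "a \<in> dual scale" and b: "b \<in> dual scale" by auto
    have "m a b x = (\<Sum>e\<in>Basis. a e * m (?c e) b x)"
      by (rule functional_on_dual_expand[where \<phi> = "\<lambda>a. m a b x"])
        (use m a b in \<open>auto simp: bilinear_mult_def fscale_def\<close>)
    also have "\<dots> = (\<Sum>e\<in>Basis. a e * (\<Sum>e'\<in>Basis. b e' * m (?c e) (?c e') x))"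
    proof (rule sum.cong[OF refl], rule arg_cong[where f = "(*) _"])
      fix e assume "e \<in> Basis"
      then show "m (?c e) b x = (\<Sum>e'\<in>Basis. b e' * m (?c e) (?c e') x)"
        by (intro functional_on_dual_expand[where \<phi> = "\<lambda>b. m (?c e) b x"])
          (use m b coord_dual in \<open>auto simp: bilinear_mult_def fscale_def\<close>)
    qed
    finally show ?thesis
      using a b by (simp add: linear_dual_def restrict2_def sum_fun_apply tscale_def pure_tensor_def
          sum_distrib_left mult_ac)
  next
    case False
    then show ?thesis
      by (auto simp: linear_dual_def restrict2_def sum_fun_apply tscale_def pure_tensor_def)
  qed
  then have "linear_dual scale m x = ?u" by blast
  also have "?u \<in> tensor_space scale"
    unfolding tensor_space_def
    by (intro T.span_sum T.span_scale T.span_base) auto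
  finally show ?thesis .
qed

end


section \<open>Coalgebras and bialgebras\<close>

definition special_pre_leibniz_coalgebra ::
  "('k::field \<Rightarrow> 'a::ab_group_add \<Rightarrow> 'a) \<Rightarrow> ('a \<Rightarrow> ('a, 'k) tensor2) \<Rightarrow> ('a \<Rightarrow> ('a, 'k) tensor2)
     \<Rightarrow> bool" where
  "special_pre_leibniz_coalgebra s vtheta \<theta> \<longleftrightarrow>
     (let \<eta> = (\<lambda>x. vtheta x + \<theta> x) in
        Vector_Spaces.linear s tscale vtheta \<and> range vtheta \<subseteq> tensor_space s \<and>
        Vector_Spaces.linear s tscale \<theta> \<and> range \<theta> \<subseteq> tensor_space s \<and>
        (\<forall>x. comul_id s \<eta> (\<eta> x) + flip_id (id_comul s \<eta> (\<eta> x)) - id_comul s \<eta> (\<eta> x) = 0) \<and>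
        (\<forall>x. \<theta> x = - flip (\<theta> x)) \<and>
        (\<forall>x. id_comul s \<theta> (\<eta> x) = comul_id s \<eta> (\<theta> x) + flip_id (id_comul s \<eta> (\<theta> x))) \<and>
        (\<forall>x. id_comul s \<theta> (vtheta x) = 0))"

definition special_pre_leibniz_bialgebra ::
  "('k::field \<Rightarrow> 'a::ab_group_add \<Rightarrow> 'a) \<Rightarrow> ('a \<Rightarrow> 'a \<Rightarrow> 'a) \<Rightarrow> ('a \<Rightarrow> 'a \<Rightarrow> 'a)
     \<Rightarrow> ('a \<Rightarrow> ('a, 'k) tensor2) \<Rightarrow> ('a \<Rightarrow> ('a, 'k) tensor2) \<Rightarrow> bool" where
  "special_pre_leibniz_bialgebra s succ prec vtheta \<theta> \<longleftrightarrow>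
     (let circ = sub_adjacent succ prec;
          \<eta> = (\<lambda>x. vtheta x + \<theta> x);
          id_minus_flip = (\<lambda>t. t - flip t)
      in
        special_pre_leibniz_algebra s UNIV succ prec \<and>
        special_pre_leibniz_coalgebra s vtheta \<theta> \<and>
        (\<forall>x y. \<eta> (prec x y) =
            id_minus_flip (tensor_map s id (Lmul prec x) (\<eta> y))
          + id_minus_flip (tensor_map s id (Rmul prec y) (\<eta> x))) \<and>
        (\<forall>x y. tensor_map s (Lmul circ x) id (\<eta> y) =
            tensor_map s (Lmul prec x) id (\<eta> y)
          + tensor_map s id (Rmul circ y) (\<eta> x)
          - tensor_map s id (Rmul circ y) (\<theta> x)) \<and>
        (\<forall>x y. \<theta> (circ x y) =
            (tensor_map s id (Lmul circ x) (\<theta> y) + tensor_map s (Lmul circ x) id (\<theta> y))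
          - (tensor_map s id (Lmul circ y) (\<theta> x) + tensor_map s (Lmul circ y) id (\<theta> x))) \<and>
        (\<forall>x y. \<eta> (circ x y) =
            tensor_map s id (Rmul circ y) (\<eta> x)
          + (tensor_map s id (Lmul circ x) (\<eta> y) + tensor_map s (Lmul prec x) id (\<eta> y))
          - tensor_map s (Lmul prec y) id (\<theta> x)))"


section \<open>Manin triples\<close>

definition form_d :: "'a \<times> ('a \<Rightarrow> 'k::field) \<Rightarrow> 'a \<times> ('a \<Rightarrow> 'k) \<Rightarrow> 'k" where
  "form_d = (\<lambda>(x, a) (y, b). b x + a y)"

definition contains_A ::
  "('a::zero \<times> ('a \<Rightarrow> 'k::field) \<Rightarrow> 'a \<times> ('a \<Rightarrow> 'k) \<Rightarrow> 'a \<times> ('a \<Rightarrow> 'k)) \<Rightarrow> ('a \<Rightarrow> 'a \<Rightarrow> 'a) \<Rightarrow> bool"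
  where
  "contains_A md m \<longleftrightarrow> (\<forall>x y. md (x, 0) (y, 0) = (m x y, 0))"

definition contains_dual ::
  "('k::field \<Rightarrow> 'a::ab_group_add \<Rightarrow> 'a)
     \<Rightarrow> ('a \<times> ('a \<Rightarrow> 'k) \<Rightarrow> 'a \<times> ('a \<Rightarrow> 'k) \<Rightarrow> 'a \<times> ('a \<Rightarrow> 'k))
     \<Rightarrow> (('a \<Rightarrow> 'k) \<Rightarrow> ('a \<Rightarrow> 'k) \<Rightarrow> ('a \<Rightarrow> 'k)) \<Rightarrow> bool" where
  "contains_dual s md m \<longleftrightarrow> (\<forall>a\<in>dual s. \<forall>b\<in>dual s. md (0, a) (0, b) = (0, m a b))"

definition manin_triple_leibniz ::
  "('k::field \<Rightarrow> 'a::ab_group_add \<Rightarrow> 'a)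
     \<Rightarrow> ('a \<times> ('a \<Rightarrow> 'k) \<Rightarrow> 'a \<times> ('a \<Rightarrow> 'k) \<Rightarrow> 'a \<times> ('a \<Rightarrow> 'k))
     \<Rightarrow> ('a \<Rightarrow> 'a \<Rightarrow> 'a) \<Rightarrow> (('a \<Rightarrow> 'k) \<Rightarrow> ('a \<Rightarrow> 'k) \<Rightarrow> ('a \<Rightarrow> 'k)) \<Rightarrow> bool" where
  "manin_triple_leibniz s circd circA circA' \<longleftrightarrow>
     leibniz_algebra s UNIV circA \<and> leibniz_algebra fscale (dual s) circA' \<and>
     leibniz_algebra (dscale s) (dsum s) circd \<and>
     contains_A circd circA \<and> contains_dual s circd circA' \<and>
     nondeg_sym_form (dscale s) (dsum s) form_d \<and> left_invariant (dsum s) circd form_d"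

definition manin_triple_special_pre_leibniz ::
  "('k::field \<Rightarrow> 'a::ab_group_add \<Rightarrow> 'a)
     \<Rightarrow> ('a \<times> ('a \<Rightarrow> 'k) \<Rightarrow> 'a \<times> ('a \<Rightarrow> 'k) \<Rightarrow> 'a \<times> ('a \<Rightarrow> 'k))
     \<Rightarrow> ('a \<times> ('a \<Rightarrow> 'k) \<Rightarrow> 'a \<times> ('a \<Rightarrow> 'k) \<Rightarrow> 'a \<times> ('a \<Rightarrow> 'k))
     \<Rightarrow> ('a \<Rightarrow> 'a \<Rightarrow> 'a) \<Rightarrow> ('a \<Rightarrow> 'a \<Rightarrow> 'a)
     \<Rightarrow> (('a \<Rightarrow> 'k) \<Rightarrow> ('a \<Rightarrow> 'k) \<Rightarrow> ('a \<Rightarrow> 'k)) \<Rightarrow> (('a \<Rightarrow> 'k) \<Rightarrow> ('a \<Rightarrow> 'k) \<Rightarrow> ('a \<Rightarrow> 'k)) \<Rightarrow> bool"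
  where
  "manin_triple_special_pre_leibniz s succd precd succA precA succA' precA' \<longleftrightarrow>
     special_pre_leibniz_algebra s UNIV succA precA \<and>
     special_pre_leibniz_algebra fscale (dual s) succA' precA' \<and>
     quadratic_special_pre_leibniz_algebra (dscale s) (dsum s) succd precd form_d \<and>
     contains_A succd succA \<and> contains_A precd precA \<and>
     contains_dual s succd succA' \<and> contains_dual s precd precA'"

definition circ_d ::
  "('k::field \<Rightarrow> 'a::ab_group_add \<Rightarrow> 'a) \<Rightarrow> ('a \<Rightarrow> 'a \<Rightarrow> 'a) \<Rightarrow> ('a \<Rightarrow> 'a \<Rightarrow> 'a)
     \<Rightarrow> (('a \<Rightarrow> 'k) \<Rightarrow> ('a \<Rightarrow> 'k) \<Rightarrow> ('a \<Rightarrow> 'k)) \<Rightarrow> (('a \<Rightarrow> 'k) \<Rightarrow> ('a \<Rightarrow> 'k) \<Rightarrow> ('a \<Rightarrow> 'k))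
     \<Rightarrow> 'a \<times> ('a \<Rightarrow> 'k) \<Rightarrow> 'a \<times> ('a \<Rightarrow> 'k) \<Rightarrow> 'a \<times> ('a \<Rightarrow> 'k)" where
  "circ_d s succA precA succA' precA' = (\<lambda>(x, a) (y, b).
     let circA = sub_adjacent succA precA; circA' = sub_adjacent succA' precA' in
     (circA x y + dual_rep' s (Lmul circA') a y - dual_rep' s (Lmul precA') b x,
      circA' a b + dual_rep (Lmul circA) x b - dual_rep (Lmul precA) y a))"

definition succ_d ::
  "('k::field \<Rightarrow> 'a::ab_group_add \<Rightarrow> 'a) \<Rightarrow> ('a \<Rightarrow> 'a \<Rightarrow> 'a)
     \<Rightarrow> (('a \<Rightarrow> 'k) \<Rightarrow> ('a \<Rightarrow> 'k) \<Rightarrow> ('a \<Rightarrow> 'k))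
     \<Rightarrow> 'a \<times> ('a \<Rightarrow> 'k) \<Rightarrow> 'a \<times> ('a \<Rightarrow> 'k) \<Rightarrow> 'a \<times> ('a \<Rightarrow> 'k)" where
  "succ_d s succA succA' = (\<lambda>(x, a) (y, b).
     (succA x y + (dual_rep' s (Lmul succA') a y + dual_rep' s (Rmul succA') a y)
        - dual_rep' s (Rmul succA') b x,
      succA' a b + (dual_rep (Lmul succA) x b + dual_rep (Rmul succA) x b)
        - dual_rep (Rmul succA) y a))"

definition prec_d ::
  "('k::field \<Rightarrow> 'a::ab_group_add \<Rightarrow> 'a) \<Rightarrow> ('a \<Rightarrow> 'a \<Rightarrow> 'a) \<Rightarrow> ('a \<Rightarrow> 'a \<Rightarrow> 'a)
     \<Rightarrow> (('a \<Rightarrow> 'k) \<Rightarrow> ('a \<Rightarrow> 'k) \<Rightarrow> ('a \<Rightarrow> 'k)) \<Rightarrow> (('a \<Rightarrow> 'k) \<Rightarrow> ('a \<Rightarrow> 'k) \<Rightarrow> ('a \<Rightarrow> 'k))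
     \<Rightarrow> 'a \<times> ('a \<Rightarrow> 'k) \<Rightarrow> 'a \<times> ('a \<Rightarrow> 'k) \<Rightarrow> 'a \<times> ('a \<Rightarrow> 'k)" where
  "prec_d s succA precA succA' precA' = (\<lambda>(x, a) (y, b).
     let circA = sub_adjacent succA precA; circA' = sub_adjacent succA' precA' in
     (precA x y - dual_rep' s (Rmul circA') a y + dual_rep' s (Rmul circA') b x,
      precA' a b - dual_rep (Rmul circA) x b + dual_rep (Rmul circA) y a))"

end

theory Submission
  imports Defs
begin

text \<open>
  Everything is reduced to the Leibniz identity for \<open>\<circ>\<^sub>d\<close>. The form \<open>B\<^sub>d\<close> is always left-invariant
  for \<open>\<circ>\<^sub>d\<close>, and \<open>\<succ>\<^sub>d\<close>, \<open>\<prec>\<^sub>d\<close> are the multiplications it induces; a Leibniz algebra with a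
  nondegenerate symmetric left-invariant form is special pre-Leibniz for the induced
  multiplications. Conversely, in (b) and (c) the pairings of the mixed products with \<open>A\<close> and
  \<open>A\<^sup>*\<close> are dictated by left-invariance and by the two subalgebras, so the multiplication must be
  \<open>\<circ>\<^sub>d\<close>.

  For (a), let \<open>F(X,Y,Z,W) = B\<^sub>d(X(YZ) - (XY)Z - Y(XZ), W)\<close>, which by invariance is
  \<open>B\<^sub>d(XZ, YW) - B\<^sub>d(YZ, XW) + B\<^sub>d(W\<prec>Z, XY)\<close> and is antisymmetric in \<open>Z\<close>, \<open>W\<close>. On arguments from \<open>A\<close> and
  \<open>A\<^sup>*\<close>, it vanishes because of the axioms of \<open>A\<close> if at most one argument lies in \<open>A\<^sup>*\<close>, and dually.
  The four remaining values \<open>F(a,b,x,y)\<close>, \<open>F(x,a,y,b) + F(a,x,y,b)\<close>, \<open>F(x,y,a,b)\<close> and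
  \<open>F(a,x,y,b)\<close> vanish exactly when the four bialgebra conditions hold, in this order.
\<close>

section \<open>Bilinear multiplications on a subspace\<close>

lemma bilinear_multD:
  assumes "bilinear_mult s S m"
  shows "vector_space s" "module.subspace s S"
    and "\<And>x y. x \<in> S \<Longrightarrow> y \<in> S \<Longrightarrow> m x y \<in> S"
    and "\<And>x y z. x \<in> S \<Longrightarrow> y \<in> S \<Longrightarrow> z \<in> S \<Longrightarrow> m (x + y) z = m x z + m y z"
    and "\<And>x y z. x \<in> S \<Longrightarrow> y \<in> S \<Longrightarrow> z \<in> S \<Longrightarrow> m x (y + z) = m x y + m x z"
    and "\<And>c x y. x \<in> S \<Longrightarrow> y \<in> S \<Longrightarrow> m (s c x) y = s c (m x y)"
    and "\<And>c x y. x \<in> S \<Longrightarrow> y \<in> S \<Longrightarrow> m x (s c y) = s c (m x y)"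
  using assms by (auto simp: bilinear_mult_def)

lemma subspace_closed:
  assumes "vector_space s" "module.subspace s S"
  shows "x \<in> S \<Longrightarrow> - x \<in> S" "x \<in> S \<Longrightarrow> y \<in> S \<Longrightarrow> x + y \<in> S"
    "x \<in> S \<Longrightarrow> y \<in> S \<Longrightarrow> x - y \<in> S" "0 \<in> S" "x \<in> S \<Longrightarrow> s c x \<in> S"
proof -
  interpret vector_space s by fact
  show "x \<in> S \<Longrightarrow> - x \<in> S" "x \<in> S \<Longrightarrow> y \<in> S \<Longrightarrow> x + y \<in> S"
    "x \<in> S \<Longrightarrow> y \<in> S \<Longrightarrow> x - y \<in> S" "0 \<in> S" "x \<in> S \<Longrightarrow> s c x \<in> S"
    using assms(2) by (auto simp: subspace_neg subspace_diff subspace_add subspace_0 subspace_scale)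
qed

lemma bilinear_mult_uminus:
  assumes m: "bilinear_mult s S m" and x: "x \<in> S" and y: "y \<in> S"
  shows "m (- x) y = - m x y" "m x (- y) = - m x y"
proof -
  interpret vector_space s using m by (rule bilinear_multD)
  show "m (- x) y = - m x y" "m x (- y) = - m x y"
    using bilinear_multD(6,7)[OF m x y, of "-1"] by simp_all
qed

lemma bilinear_mult_zero:
  assumes m: "bilinear_mult s S m" and x: "x \<in> S"
  shows "m 0 x = 0" "m x 0 = 0"
proof -
  interpret vector_space s using m by (rule bilinear_multD)
  have 0: "0 \<in> S" by (rule subspace_0) (rule bilinear_multD[OF m])
  show "m 0 x = 0" "m x 0 = 0"
    using bilinear_multD(6)[OF m 0 x, of 0] bilinear_multD(7)[OF m x 0, of 0] by simp_all
qed

text \<open>A multiplication is constrained only on the subspace, so two that agree there may still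
  differ as functions. This lemma and the next two transfer a structure without an equality of
  functions.\<close>

lemma bilinear_mult_cong:
  assumes "\<And>x y. x \<in> S \<Longrightarrow> y \<in> S \<Longrightarrow> m x y = m' x y" and m: "bilinear_mult s S m"
  shows "bilinear_mult s S m'"
  unfolding bilinear_mult_def
proof (intro conjI ballI allI)
  note c = subspace_closed(2,5)[OF bilinear_multD(1,2)[OF m]]
  show "vector_space s" "module.subspace s S" by (fact bilinear_multD[OF m])+
  show "m' x y \<in> S" if "x \<in> S" "y \<in> S" for x y
    using bilinear_multD(3)[OF m that] assms(1)[OF that] by simp
  show "m' (x + y) z = m' x z + m' y z" "m' x (y + z) = m' x y + m' x z"
    if "x \<in> S" "y \<in> S" "z \<in> S" for x y z
    using bilinear_multD(4,5)[OF m that] by (simp_all add: assms(1) c that)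
  show "m' (s d x) y = s d (m' x y)" "m' x (s d y) = s d (m' x y)"
    if "x \<in> S" "y \<in> S" for d x y
    using bilinear_multD(6,7)[OF m that] by (simp_all add: assms(1) c that)
qed

lemma leibniz_algebra_cong:
  assumes eq: "\<And>x y. x \<in> S \<Longrightarrow> y \<in> S \<Longrightarrow> m x y = m' x y" and m: "leibniz_algebra s S m"
  shows "leibniz_algebra s S m'"
proof -
  have b: "bilinear_mult s S m" using m by (simp add: leibniz_algebra_def)
  have b': "bilinear_mult s S m'" by (rule bilinear_mult_cong[OF _ b]) (rule eq)
  show ?thesis
    unfolding leibniz_algebra_def
  proof (intro conjI ballI b')
    fix x y z assume *: "x \<in> S" "y \<in> S" "z \<in> S"
    then have "m x (m y z) = m (m x y) z + m y (m x z)"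
      using m unfolding leibniz_algebra_def by blast
    then show "m' x (m' y z) = m' (m' x y) z + m' y (m' x z)"
      using * by (simp only: eq[symmetric] bilinear_multD(3)[OF b])
  qed
qed

lemma special_pre_leibniz_algebra_cong:
  assumes eq: "\<And>x y. x \<in> S \<Longrightarrow> y \<in> S \<Longrightarrow> p x y = p' x y"
    "\<And>x y. x \<in> S \<Longrightarrow> y \<in> S \<Longrightarrow> q x y = q' x y"
    and m: "special_pre_leibniz_algebra s S p q"
  shows "special_pre_leibniz_algebra s S p' q'"
proof -
  have b: "bilinear_mult s S p" "bilinear_mult s S q"
    "leibniz_algebra s S (sub_adjacent p q)"
    using m by (simp_all add: special_pre_leibniz_algebra_def Let_def)
  have l: "leibniz_algebra s S (sub_adjacent p' q')"
    by (rule leibniz_algebra_cong[OF _ b(3)]) (simp add: sub_adjacent_def eq)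
  have c: "sub_adjacent p q x y \<in> S" if "x \<in> S" "y \<in> S" for x y
    using b(3) that by (auto simp: leibniz_algebra_def bilinear_mult_def)
  have s: "sub_adjacent p' q' x y = sub_adjacent p q x y" if "x \<in> S" "y \<in> S" for x y
    using that by (simp add: sub_adjacent_def eq)
  have p': "bilinear_mult s S p'" by (rule bilinear_mult_cong[OF _ b(1)]) (rule eq)
  have q': "bilinear_mult s S q'" by (rule bilinear_mult_cong[OF _ b(2)]) (rule eq)
  note q = bilinear_multD(3)[OF b(2)]
  show ?thesis
    unfolding special_pre_leibniz_algebra_def Let_def
  proof (intro conjI ballI p' q' l)
    fix x y assume xy: "x \<in> S" "y \<in> S"
    then have "q x y = - q y x"
      using m unfolding special_pre_leibniz_algebra_def Let_def by blast
    then show "q' x y = - q' y x" using xy by (simp add: eq)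
    fix z assume z: "z \<in> S"
    have "sub_adjacent p q x (q y z) = q (sub_adjacent p q x y) z + q y (sub_adjacent p q x z)"
      "sub_adjacent p q x (q y z) = q x (q y z)"
      using m xy z unfolding special_pre_leibniz_algebra_def Let_def by blast+
    then show "sub_adjacent p' q' x (q' y z)
        = q' (sub_adjacent p' q' x y) z + q' y (sub_adjacent p' q' x z)"
      "sub_adjacent p' q' x (q' y z) = q' x (q' y z)"
      using xy z by (simp_all only: s c q eq(2)[symmetric])
  qed
qed

section \<open>Nondegenerate symmetric forms and the structures they induce\<close>

lemma nondeg_sym_formD:
  assumes "nondeg_sym_form s S B"
  shows "\<And>x y z. x \<in> S \<Longrightarrow> y \<in> S \<Longrightarrow> z \<in> S \<Longrightarrow> B (x + y) z = B x z + B y z"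
    "\<And>x y z. x \<in> S \<Longrightarrow> y \<in> S \<Longrightarrow> z \<in> S \<Longrightarrow> B x (y + z) = B x y + B x z"
    "\<And>c x y. x \<in> S \<Longrightarrow> y \<in> S \<Longrightarrow> B (s c x) y = c * B x y"
    "\<And>c x y. x \<in> S \<Longrightarrow> y \<in> S \<Longrightarrow> B x (s c y) = c * B x y"
    "\<And>x y. x \<in> S \<Longrightarrow> y \<in> S \<Longrightarrow> B x y = B y x"
    "\<And>x. x \<in> S \<Longrightarrow> (\<And>y. y \<in> S \<Longrightarrow> B x y = 0) \<Longrightarrow> x = 0"
proof -
  note B = assms[unfolded nondeg_sym_form_def]
  note add = B[THEN conjunct1, rule_format]
  note scl = B[THEN conjunct2, THEN conjunct1, rule_format]
  note sym = B[THEN conjunct2, THEN conjunct2, THEN conjunct1, rule_format]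
  note nondeg = B[THEN conjunct2, THEN conjunct2, THEN conjunct2, rule_format]
  show "B (x + y) z = B x z + B y z" "B x (y + z) = B x y + B x z"
    if "x \<in> S" "y \<in> S" "z \<in> S" for x y z
    using add[OF that] by simp_all
  show "B (s c x) y = c * B x y" "B x (s c y) = c * B x y" if "x \<in> S" "y \<in> S" for c x y
    using scl[OF that, of c] by simp_all
  show "B x y = B y x" if "x \<in> S" "y \<in> S" for x y
    by (rule sym[OF that])
  show "x = 0" if "x \<in> S" "\<And>y. y \<in> S \<Longrightarrow> B x y = 0" for x
    by (rule nondeg[OF that(1)]) (rule that(2))
qed

lemma sym_form_uminus:
  assumes "vector_space s" "nondeg_sym_form s S B" "x \<in> S" "y \<in> S"
  shows "B (- x) y = - B x y" "B x (- y) = - B x y"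
proof -
  interpret vector_space s by fact
  show "B (- x) y = - B x y" "B x (- y) = - B x y"
    using nondeg_sym_formD(3,4)[OF assms(2-4), of "-1"] by simp_all
qed

lemma nondeg_sym_form_eqI:
  assumes v: "vector_space s" "module.subspace s S" and B: "nondeg_sym_form s S B"
    and x: "x \<in> S" and y: "y \<in> S" and eq: "\<And>z. z \<in> S \<Longrightarrow> B x z = B y z"
  shows "x = y"
proof -
  have y': "- y \<in> S" by (rule subspace_closed(1)[OF v y])
  have "B (x + - y) z = 0" if "z \<in> S" for z
    unfolding nondeg_sym_formD(1)[OF B x y' that] sym_form_uminus(1)[OF v(1) B y that]
    by (simp add: eq that)
  then have "x + - y = 0"
    by (rule nondeg_sym_formD(6)[OF B subspace_closed(2)[OF v x y']])
  then show ?thesis by simp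
qed

text \<open>Nondegeneracy allows each axiom for \<open>prec\<close> to be tested by pairing:
  \<open>adj\<close> replaces \<open>prec\<close> by \<open>circ\<close>, and left-invariance moves
  a left factor across the form. What remains follows from symmetry of the form or from the Leibniz
  identity for \<open>circ\<close>. In these identities \<open>succ\<close> occurs only through
  \<open>sum\<close>.\<close>

lemma special_pre_leibniz_algebra_of_form:
  assumes L: "leibniz_algebra s S circ" and B: "nondeg_sym_form s S B"
    and inv: "left_invariant S circ B"
    and p: "bilinear_mult s S succ" and q: "bilinear_mult s S prec"
    and sum: "\<And>x y. x \<in> S \<Longrightarrow> y \<in> S \<Longrightarrow> sub_adjacent succ prec x y = circ x y"
    and adj: "\<And>x y z. x \<in> S \<Longrightarrow> y \<in> S \<Longrightarrow> z \<in> S \<Longrightarrow> B (prec x y) z = - B x (circ z y)"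
  shows "special_pre_leibniz_algebra s S succ prec"
proof -
  have c: "bilinear_mult s S circ"
    and leib: "\<And>x y z. x \<in> S \<Longrightarrow> y \<in> S \<Longrightarrow> z \<in> S \<Longrightarrow>
      circ x (circ y z) = circ (circ x y) z + circ y (circ x z)"
    using L unfolding leibniz_algebra_def by blast+
  note v = bilinear_multD(1,2)[OF c]
  note [simp] = subspace_closed[OF v] bilinear_multD(3)[OF c] bilinear_multD(3)[OF q]
    bilinear_mult_uminus[OF c]
  note eqI = nondeg_sym_form_eqI[OF v B]
  note Badd = nondeg_sym_formD(1,2)[OF B]
  note Bm = sym_form_uminus[OF v(1) B]
  have li: "B (circ x y) z = - B y (circ x z)" if "x \<in> S" "y \<in> S" "z \<in> S" for x y z
    using inv that by (simp add: left_invariant_def eq_neg_iff_add_eq_0)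
  note sym = nondeg_sym_formD(5)[OF B]
  have anti: "prec x y = - prec y x" if "x \<in> S" "y \<in> S" for x y
  proof (rule eqI)
    fix z assume z: "z \<in> S"
    show "B (prec x y) z = B (- prec y x) z"
      using that z li[of z x y] sym[of "circ z x" y] by (simp add: Bm adj)
  qed (use that in simp_all)
  have der: "circ x (prec y z) = prec (circ x y) z + prec y (circ x z)"
    if "x \<in> S" "y \<in> S" "z \<in> S" for x y z
  proof (rule eqI)
    fix w assume w: "w \<in> S"
    \<comment> \<open>Both sides are brought to the form \<open>B y _\<close>; there the claim is
      the Leibniz identity for \<open>x\<close>, \<open>w\<close>, \<open>z\<close>.\<close>
    have "B (circ x (prec y z)) w = B y (circ (circ x w) z)"
      using that w by (simp add: adj li)
    moreover have "B (prec (circ x y) z + prec y (circ x z)) w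
        = B y (circ x (circ w z)) - B y (circ w (circ x z))"
      using that w by (simp add: adj li Badd)
    moreover have "B y (circ x (circ w z)) = B y (circ (circ x w) z) + B y (circ w (circ x z))"
      using that w by (simp add: leib[of x w z] Badd)
    ultimately show "B (circ x (prec y z)) w = B (prec (circ x y) z + prec y (circ x z)) w"
      by simp
  qed (use that in simp_all)
  have idem: "circ x (prec y z) = prec x (prec y z)" if "x \<in> S" "y \<in> S" "z \<in> S" for x y z
  proof (rule eqI)
    fix w assume w: "w \<in> S"
    \<comment> \<open>The sum of the Leibniz identities for \<open>x\<close>, \<open>w\<close>,
      \<open>z\<close> and for \<open>w\<close>, \<open>x\<close>, \<open>z\<close>: left
      multiplication by a symmetrised product is zero.\<close>
    have "circ (circ x w) z + circ (circ w x) z = 0"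
      using leib[OF that(1) w that(3)] leib[OF w that(1) that(3)] by (simp add: algebra_simps)
    then have "circ (circ x w) z = - circ (circ w x) z"
      by (simp add: eq_neg_iff_add_eq_0)
    moreover have "B (prec x (prec y z)) w = B (circ w x) (prec y z)"
      using that w by (simp add: adj li)
    moreover have "\<dots> = - B y (circ (circ w x) z)"
      using that w sym[of "circ w x" "prec y z"] by (simp add: adj)
    ultimately show "B (circ x (prec y z)) w = B (prec x (prec y z)) w"
      using that w by (simp add: li adj Bm)
  qed (use that in simp_all)
  have l: "leibniz_algebra s S (sub_adjacent succ prec)"
    by (rule leibniz_algebra_cong[OF _ L]) (simp add: sum)
  show ?thesis
    unfolding special_pre_leibniz_algebra_def Let_def
  proof (intro conjI ballI p q l)
    fix x y assume xy: "x \<in> S" "y \<in> S"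
    show "prec x y = - prec y x" by (rule anti[OF xy])
    fix z assume z: "z \<in> S"
    show "sub_adjacent succ prec x (prec y z)
        = prec (sub_adjacent succ prec x y) z + prec y (sub_adjacent succ prec x z)"
      using der[OF xy z] xy z by (simp add: sum)
    show "sub_adjacent succ prec x (prec y z) = prec x (prec y z)"
      using idem[OF xy z] xy z by (simp add: sum)
  qed
qed

section \<open>Dual representations and the form on the direct sum\<close>

lemma Lmul_eq: "Lmul m = m"
  by (simp add: Lmul_def fun_eq_iff)

lemma bilinear_mult_Rmul: "bilinear_mult s S m \<Longrightarrow> bilinear_mult s S (Rmul m)"
  by (auto simp: bilinear_mult_def Rmul_def)

lemma bilinear_mult_plus_minus:
  assumes m: "bilinear_mult s S m" and n: "bilinear_mult s S n"
  shows "bilinear_mult s S (\<lambda>x y. m x y + n x y)" "bilinear_mult s S (\<lambda>x y. m x y - n x y)"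
proof -
  interpret vector_space s using m by (rule bilinear_multD)
  note v = bilinear_multD(1,2)[OF m]
  show "bilinear_mult s S (\<lambda>x y. m x y + n x y)" "bilinear_mult s S (\<lambda>x y. m x y - n x y)"
    unfolding bilinear_mult_def
    using subspace_closed(2,3)[OF v] v
    by (simp_all add: bilinear_multD(3-7)[OF m] bilinear_multD(3-7)[OF n] scale_right_distrib
        scale_right_diff_distrib)
qed

lemma form_d_pair [simp]: "form_d (x, a) (y, b) = b x + a y"
  by (simp add: form_d_def)

context finite_dimensional_vector_space
begin

lemma vector_space_dscale: "vector_space (dscale scale)"
  by unfold_locales (auto simp: dscale_def fscale_def fun_eq_iff algebra_simps)

lemma mem_dual_iff:
  "f \<in> dual scale \<longleftrightarrow> (\<forall>x y. f (x + y) = f x + f y) \<and> (\<forall>c x. f (scale c x) = c * f x)"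
  unfolding dual_def mem_Collect_eq Vector_Spaces.linear_iff
  by (auto simp: vector_space_axioms intro!: vector_space.intro simp: algebra_simps)

lemmas dual_closed [simp] = subspace_closed[OF vector_space_fscale subspace_dual]

lemma dual_minus:
  assumes "f \<in> dual scale"
  shows "f (- x) = - f x" "f (x - y) = f x - f y" "f 0 = 0"
  using dual_scale[OF assms, of "-1"] dual_add[OF assms, of x "- y"] dual_scale[OF assms, of 0 0]
    dual_scale[OF assms, of "-1" y]
  by simp_all

lemma mem_dsum [simp]: "(x, a) \<in> dsum scale \<longleftrightarrow> a \<in> dual scale"
  by (simp add: dsum_def)

lemma subspace_dsum: "module.subspace (dscale scale) (dsum scale)"
proof -
  interpret D: vector_space "dscale scale" by (rule vector_space_dscale)
  show ?thesis
    by (auto simp: D.subspace_def dsum_def dscale_def zero_prod_def plus_prod_def)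
qed

text \<open>The coordinate functionals of \<open>Basis\<close> belong to the dual space and
  determine a vector.\<close>

lemma dual_separates:
  assumes "\<And>f. f \<in> dual scale \<Longrightarrow> f x = f y"
  shows "x = y"
proof -
  have "(\<Sum>e\<in>Basis. scale (representation Basis x e) e)
      = (\<Sum>e\<in>Basis. scale (representation Basis y e) e)"
    using assms[OF coord_dual] by simp
  moreover have "(\<Sum>e\<in>Basis. scale (representation Basis v e) e) = v" for v
    by (rule sum_representation_eq) (auto simp: independent_Basis span_Basis finite_Basis)
  ultimately show ?thesis by simp
qed

lemma nondeg_sym_form_d: "nondeg_sym_form (dscale scale) (dsum scale) form_d"
  unfolding nondeg_sym_form_def
proof (intro conjI ballI allI impI)
  fix X assume X: "X \<in> dsum scale" and *: "\<forall>Y\<in>dsum scale. form_d X Y = 0"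
  obtain x a where [simp]: "X = (x, a)" by (cases X)
  have a: "a \<in> dual scale" using X by simp
  have "f x = f 0" if "f \<in> dual scale" for f
    using *[rule_format, of "(0, f)"] that a by (simp add: dual_minus)
  then have "x = 0" by (rule dual_separates)
  moreover have "a z = 0" for z
    using *[rule_format, of "(z, 0)"] by simp
  ultimately show "X = 0" by (auto simp: zero_prod_def)
qed (auto simp: dsum_def dscale_def fscale_def form_d_def dual_add dual_scale algebra_simps)

lemmas form_d_eqI = nondeg_sym_form_eqI[OF vector_space_dscale subspace_dsum nondeg_sym_form_d]

text \<open>The witness has crossed components, since the form pairs vectors with functionals: the
  restriction of \<open>\<phi>\<close> to the dual space yields the vector, through the bidual, and
  its restriction to vectors is the functional. This supplies existence for the definite description
  in \<open>induced_prec\<close>.\<close>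

lemma form_d_represents:
  assumes add: "\<And>X Y. X \<in> dsum scale \<Longrightarrow> Y \<in> dsum scale \<Longrightarrow> \<phi> (X + Y) = \<phi> X + \<phi> Y"
    and scl: "\<And>c X. X \<in> dsum scale \<Longrightarrow> \<phi> (dscale scale c X) = c * \<phi> X"
  shows "\<exists>W\<in>dsum scale. \<forall>Z\<in>dsum scale. form_d W Z = \<phi> Z"
proof (intro bexI ballI)
  let ?W = "(from_bidual scale (\<lambda>f. \<phi> (0, f)), \<lambda>x. \<phi> (x, 0))"
  have "\<phi> (x + y, 0) = \<phi> (x, 0) + \<phi> (y, 0)" for x y
    using add[of "(x, 0)" "(y, 0)"] by simp
  moreover have "\<phi> (scale c x, 0) = c * \<phi> (x, 0)" for c x
    using scl[of "(x, 0)" c] by (simp add: dscale_def fscale_def flip: zero_fun_def)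
  ultimately show "?W \<in> dsum scale" by (simp add: mem_dual_iff)
  fix Z assume "Z \<in> dsum scale"
  then obtain z c where Z: "Z = (z, c)" "c \<in> dual scale" by (auto simp: dsum_def)
  have "c (from_bidual scale (\<lambda>f. \<phi> (0, f))) = \<phi> (0, c)"
  proof (rule from_bidual_eq[OF _ _ Z(2)])
    show "\<phi> (0, f + g) = \<phi> (0, f) + \<phi> (0, g)" if "f \<in> dual scale" "g \<in> dual scale" for f g
      using add[of "(0, f)" "(0, g)"] that by simp
    show "\<phi> (0, fscale d f) = d * \<phi> (0, f)" if "f \<in> dual scale" for d f
      using scl[of "(0, f)" d] that by (simp add: dscale_def)
  qed
  then show "form_d ?W Z = \<phi> Z"
    using add[of "(z, 0)" "(0, c)"] Z by simp
qed

lemma dual_mult: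
  assumes "bilinear_mult scale UNIV m" "a \<in> dual scale"
  shows "(\<lambda>y. a (m x y)) \<in> dual scale" "(\<lambda>y. a (m y x)) \<in> dual scale"
  using bilinear_multD(4-7)[OF assms(1)] assms(2)
  by (auto simp: mem_dual_iff)

lemma dual_rep_mem [simp]:
  assumes "bilinear_mult scale UNIV m" "a \<in> dual scale"
  shows "dual_rep m x a \<in> dual scale"
  using dual_closed(1)[OF dual_mult(1)[OF assms]]
  by (simp add: dual_rep_def fun_Compl_def)

text \<open>Bilinearity of \<open>m\<close> makes the argument of \<open>from_bidual\<close> linear
  on the dual space, so it is evaluation at a vector. With this and \<open>dual_separates\<close>,
  identities for \<open>dual_rep'\<close> reduce to identities between scalars.\<close>

lemma dual_rep'_eval:
  assumes m: "bilinear_mult fscale (dual scale) m" and a: "a \<in> dual scale" and f: "f \<in> dual scale"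
  shows "f (dual_rep' scale m a y) = - m a f y"
proof -
  have "f (dual_rep' scale m a y) = dual_rep m a (\<lambda>f. f y) f"
    unfolding dual_rep'_def
  proof (rule from_bidual_eq[OF _ _ f])
    fix g h assume g: "g \<in> dual scale" and h: "h \<in> dual scale"
    show "dual_rep m a (\<lambda>f. f y) (g + h)
        = dual_rep m a (\<lambda>f. f y) g + dual_rep m a (\<lambda>f. f y) h"
      unfolding dual_rep_def bilinear_multD(5)[OF m a g h] by simp
  next
    fix c g assume g: "g \<in> dual scale"
    show "dual_rep m a (\<lambda>f. f y) (fscale c g) = c * dual_rep m a (\<lambda>f. f y) g"
      unfolding dual_rep_def bilinear_multD(7)[OF m a g] by (simp add: fscale_def)
  qed
  then show ?thesis by (simp add: dual_rep_def)
qed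

lemma dual_rep'_linear:
  assumes m: "bilinear_mult fscale (dual scale) m" and a: "a \<in> dual scale" and b: "b \<in> dual scale"
  shows "dual_rep' scale m (a + b) y = dual_rep' scale m a y + dual_rep' scale m b y"
    "dual_rep' scale m a (y + z) = dual_rep' scale m a y + dual_rep' scale m a z"
    "dual_rep' scale m (fscale c a) y = scale c (dual_rep' scale m a y)"
    "dual_rep' scale m a (scale c y) = scale c (dual_rep' scale m a y)"
  using a b
  by (auto intro!: dual_separates simp: dual_rep'_eval[OF m] dual_add dual_scale dual_minus
     bilinear_multD(4,6)[OF m] dual_add[OF bilinear_multD(3)[OF m]]
     dual_scale[OF bilinear_multD(3)[OF m]] dual_minus[OF bilinear_multD(3)[OF m]]
     fscale_def[of c "m _ _"] algebra_simps)

lemma dual_rep'_zero: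
  assumes m: "bilinear_mult fscale (dual scale) m"
  shows "dual_rep' scale m 0 y = 0" "a \<in> dual scale \<Longrightarrow> dual_rep' scale m a 0 = 0"
  by (auto intro!: dual_separates simp: dual_rep'_eval[OF m] dual_minus
      dual_minus[OF bilinear_multD(3)[OF m]] bilinear_mult_zero[OF m])

lemma dual_rep_linear:
  assumes m: "bilinear_mult scale UNIV m" and a: "a \<in> dual scale" and b: "b \<in> dual scale"
  shows "dual_rep m (x + y) a = dual_rep m x a + dual_rep m y a"
    "dual_rep m x (a + b) = dual_rep m x a + dual_rep m x b"
    "dual_rep m (scale c x) a = fscale c (dual_rep m x a)"
    "dual_rep m x (fscale c a) = fscale c (dual_rep m x a)"
  using a b
  by (simp_all add: dual_rep_def fun_eq_iff dual_add dual_scale dual_minus fscale_def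
     bilinear_multD(4,6)[OF m])

lemma bilinear_mult_pair:
  assumes m: "bilinear_mult scale UNIV m" and n: "bilinear_mult fscale (dual scale) n"
  shows "bilinear_mult (dscale scale) (dsum scale) (\<lambda>(x, a) (y, b). (m x y, n a b))"
  unfolding bilinear_mult_def
  by (auto simp: vector_space_dscale subspace_dsum[unfolded dsum_def] dsum_def dscale_def
      bilinear_multD(4-7)[OF m]
      bilinear_multD(3-7)[OF n])

lemma bilinear_mult_dual_reps:
  assumes m: "bilinear_mult scale UNIV m" and n: "bilinear_mult fscale (dual scale) n"
  shows "bilinear_mult (dscale scale) (dsum scale)
    (\<lambda>(x, a) (y, b). (dual_rep' scale n a y, dual_rep m x b))"
  unfolding bilinear_mult_def
  by (auto simp: vector_space_dscale subspace_dsum[unfolded dsum_def] dsum_def dscale_def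
      dual_rep'_linear[OF n]
      dual_rep_linear[OF m] dual_rep_mem[OF m])

end

section \<open>The three multiplications on the direct sum and their pairings\<close>

lemma special_pre_leibniz_algebraD:
  assumes "special_pre_leibniz_algebra s S succ prec"
  defines "circ \<equiv> sub_adjacent succ prec"
  shows "bilinear_mult s S succ" "bilinear_mult s S prec" "bilinear_mult s S circ"
    "\<And>x y. x \<in> S \<Longrightarrow> y \<in> S \<Longrightarrow> prec x y = - prec y x"
    "\<And>x y z. x \<in> S \<Longrightarrow> y \<in> S \<Longrightarrow> z \<in> S \<Longrightarrow> circ x (circ y z) = circ (circ x y) z + circ y (circ x z)"
    "\<And>x y z. x \<in> S \<Longrightarrow> y \<in> S \<Longrightarrow> z \<in> S \<Longrightarrow> circ x (prec y z) = prec (circ x y) z + prec y (circ x z)"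
    "\<And>x y z. x \<in> S \<Longrightarrow> y \<in> S \<Longrightarrow> z \<in> S \<Longrightarrow> circ x (prec y z) = prec x (prec y z)"
  using assms(1)
  unfolding special_pre_leibniz_algebra_def leibniz_algebra_def Let_def circ_def by blast+

locale pre_leibniz_pair = finite_dimensional_vector_space s Basis
  for s :: "'k::field \<Rightarrow> 'a::ab_group_add \<Rightarrow> 'a" and Basis +
  fixes succA precA :: "'a \<Rightarrow> 'a \<Rightarrow> 'a"
    and succA' precA' :: "('a \<Rightarrow> 'k) \<Rightarrow> ('a \<Rightarrow> 'k) \<Rightarrow> ('a \<Rightarrow> 'k)"
  assumes A: "special_pre_leibniz_algebra s UNIV succA precA"
    and A': "special_pre_leibniz_algebra fscale (dual s) succA' precA'"
begin

abbreviation "circA \<equiv> sub_adjacent succA precA"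
abbreviation "circA' \<equiv> sub_adjacent succA' precA'"
abbreviation "circd \<equiv> circ_d s succA precA succA' precA'"
abbreviation "succd \<equiv> succ_d s succA succA'"
abbreviation "precd \<equiv> prec_d s succA precA succA' precA'"

lemmas bilinear_A = special_pre_leibniz_algebraD(1-3)[OF A]
lemmas bilinear_A' = special_pre_leibniz_algebraD(1-3)[OF A']
lemmas bilinear_RA = bilinear_A[THEN bilinear_mult_Rmul]
lemmas bilinear_RA' = bilinear_A'[THEN bilinear_mult_Rmul]

lemmas A_closed = bilinear_A'[THEN bilinear_multD(3)]

lemma dual_mult_closed [simp]:
  assumes "a \<in> dual s"
  shows "(\<lambda>y. a (circA x y)) \<in> dual s" "(\<lambda>y. a (circA y x)) \<in> dual s"
    "(\<lambda>y. a (precA x y)) \<in> dual s" "(\<lambda>y. a (precA y x)) \<in> dual s"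
  using dual_mult[OF bilinear_A(3) assms] dual_mult[OF bilinear_A(2) assms] by auto

lemma bilinear_d:
  "bilinear_mult (dscale s) (dsum s) circd"
  "bilinear_mult (dscale s) (dsum s) succd"
  "bilinear_mult (dscale s) (dsum s) precd"
proof -
  \<comment> \<open>\<open>?P\<close> multiplies within the two summands, and \<open>?R\<close> lets
    the first argument act on the second by dual maps; \<open>Rmul\<close> exchanges the arguments
    for the terms in which the second acts on the first. All three products are sums and differences
    of such blocks.\<close>
  let ?P = "\<lambda>m n (x, a) (y, b). (m x y, n a b)"
  let ?R = "\<lambda>m n (x, a) (y, b). (dual_rep' s n a y, dual_rep m x b)"
  note P = bilinear_mult_pair[OF bilinear_A(1) bilinear_A'(1)]
    bilinear_mult_pair[OF bilinear_A(2) bilinear_A'(2)]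
    bilinear_mult_pair[OF bilinear_A(3) bilinear_A'(3)]
  note L = bilinear_mult_dual_reps[OF bilinear_A(1) bilinear_A'(1)]
    bilinear_mult_dual_reps[OF bilinear_A(2) bilinear_A'(2)]
    bilinear_mult_dual_reps[OF bilinear_A(3) bilinear_A'(3)]
  note R = bilinear_mult_dual_reps[OF bilinear_RA(1) bilinear_RA'(1)]
    bilinear_mult_dual_reps[OF bilinear_RA(3) bilinear_RA'(3)]
  note pm = bilinear_mult_plus_minus
  have "circd = (\<lambda>X Y. ?P circA circA' X Y + ?R circA circA' X Y - Rmul (?R precA precA') X Y)"
    by (simp add: circ_d_def fun_eq_iff Rmul_def Lmul_eq Let_def)
  then show "bilinear_mult (dscale s) (dsum s) circd"
    using pm(2)[OF pm(1)[OF P(3) L(3)] bilinear_mult_Rmul[OF L(2)]] by simp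
  have "succd = (\<lambda>X Y. ?P succA succA' X Y
      + (?R succA succA' X Y + ?R (Rmul succA) (Rmul succA') X Y)
      - Rmul (?R (Rmul succA) (Rmul succA')) X Y)"
    by (simp add: succ_d_def fun_eq_iff Rmul_def[of "\<lambda>(x, a). _ x a"] Lmul_eq)
  then show "bilinear_mult (dscale s) (dsum s) succd"
    using pm(2)[OF pm(1)[OF P(1) pm(1)[OF L(1) R(1)]] bilinear_mult_Rmul[OF R(1)]] by simp
  have "precd = (\<lambda>X Y. ?P precA precA' X Y - ?R (Rmul circA) (Rmul circA') X Y
      + Rmul (?R (Rmul circA) (Rmul circA')) X Y)"
    by (simp add: prec_d_def fun_eq_iff Rmul_def[of "\<lambda>(x, a). _ x a"] Let_def)
  then show "bilinear_mult (dscale s) (dsum s) precd"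
    using pm(1)[OF pm(2)[OF P(2) R(2)] bilinear_mult_Rmul[OF R(2)]] by simp
qed

text \<open>Pairing removes \<open>from_bidual\<close> and turns both components into scalars, so
  that adjointness and invariance become comparisons of six terms.\<close>

lemma form_circ_d:
  assumes "a \<in> dual s" "b \<in> dual s" "c \<in> dual s"
  shows "form_d (circd (x, a) (y, b)) (z, c)
    = c (circA x y) - circA' a c y + precA' b c x + circA' a b z - b (circA x z) + a (precA y z)"
  using assms
  by (simp add: circ_d_def Let_def Lmul_eq dual_add dual_minus dual_rep'_eval bilinear_A'
      dual_rep_def)

lemma form_prec_d:
  assumes "a \<in> dual s" "b \<in> dual s" "c \<in> dual s"
  shows "form_d (precd (x, a) (y, b)) (z, c)
    = c (precA x y) + circA' c a y - circA' c b x + precA' a b z + b (circA z x) - a (circA z y)"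
  using assms
  by (simp add: prec_d_def Let_def dual_add dual_minus dual_rep'_eval bilinear_RA'
      dual_rep_def Rmul_def)

text \<open>This identifies \<open>precd\<close> as the multiplication induced by the form from
  \<open>circd\<close>. After expansion the terms on both sides agree once anticommutativity
  reorders the factors of \<open>precA\<close> and \<open>precA'\<close>.\<close>

lemma form_prec_d_adjoint:
  assumes "X \<in> dsum s" "Y \<in> dsum s" "Z \<in> dsum s"
  shows "form_d (precd X Y) Z = - form_d X (circd Z Y)"
proof -
  obtain x a y b z c where [simp]: "X = (x, a)" "Y = (y, b)" "Z = (z, c)"
    by (cases X, cases Y, cases Z)
  have d: "a \<in> dual s" "b \<in> dual s" "c \<in> dual s" using assms by simp_all
  have c: "circd Z Y \<in> dsum s" using bilinear_multD(3)[OF bilinear_d(1)] assms by blast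
  have "form_d X (circd Z Y) = form_d (circd Z Y) X"
    by (rule nondeg_sym_formD(5)[OF nondeg_sym_form_d assms(1) c])
  moreover have "precA x y = - precA y x" "precA' b a = - precA' a b"
    using special_pre_leibniz_algebraD(4)[OF A] special_pre_leibniz_algebraD(4)[OF A'] d by blast+
  ultimately show ?thesis
    using d by (simp add: form_circ_d form_prec_d dual_minus)
qed

text \<open>Invariance is built into the formula for \<open>circd\<close> and precedes any Leibniz
  identity for it: the twelve terms cancel in pairs, those with \<open>precA\<close> and
  \<open>precA'\<close> by anticommutativity.\<close>

lemma left_invariant_circ_d: "left_invariant (dsum s) circd form_d"
  unfolding left_invariant_def
proof (intro ballI)
  fix X Y Z assume XYZ: "X \<in> dsum s" "Y \<in> dsum s" "Z \<in> dsum s"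
  obtain x a y b z c where [simp]: "X = (x, a)" "Y = (y, b)" "Z = (z, c)"
    by (cases X, cases Y, cases Z)
  have d: "a \<in> dual s" "b \<in> dual s" "c \<in> dual s" using XYZ by simp_all
  have c: "circd X Z \<in> dsum s" using bilinear_multD(3)[OF bilinear_d(1)] XYZ by blast
  have "form_d Y (circd X Z) = form_d (circd X Z) Y"
    by (rule nondeg_sym_formD(5)[OF nondeg_sym_form_d XYZ(2) c])
  moreover have "precA y z = - precA z y" "precA' c b = - precA' b c"
    using special_pre_leibniz_algebraD(4)[OF A] special_pre_leibniz_algebraD(4)[OF A'] d by blast+
  ultimately show "form_d (circd X Y) Z + form_d Y (circd X Z) = 0"
    using d by (simp add: form_circ_d dual_minus)
qed

text \<open>By anticommutativity, \<open>L\<^sub>\<succ> + R\<^sub>\<succ> - R\<^sub>\<circ> =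
  L\<^sub>\<succ> - R\<^sub>\<prec> = L\<^sub>\<circ>\<close> and \<open>R\<^sub>\<circ> -
  R\<^sub>\<succ> = R\<^sub>\<prec> = - L\<^sub>\<prec>\<close>; the mixed terms are the dual maps
  of these.\<close>

lemma sub_adjacent_d:
  assumes "X \<in> dsum s" "Y \<in> dsum s"
  shows "sub_adjacent succd precd X Y = circd X Y"
proof -
  obtain x a y b where XY: "X = (x, a)" "Y = (y, b)"
    by (cases X, cases Y)
  have d: "a \<in> dual s" "b \<in> dual s" using assms XY by simp_all
  have an: "f (precA v w) = - f (precA w v)" if "f \<in> dual s" for f v w
    using special_pre_leibniz_algebraD(4)[OF A, of v w] dual_minus(1)[OF that] by simp
  have anti': "precA' a b v = - precA' b a v" if "a \<in> dual s" "b \<in> dual s" for a b v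
    using special_pre_leibniz_algebraD(4)[OF A' that] by simp
  have c': "circA' a b v = succA' a b v + precA' a b v" for a b v
    by (simp add: sub_adjacent_def)
  have "f (fst (succd X Y + precd X Y)) = f (fst (circd X Y))" if f: "f \<in> dual s" for f
    using d f anti'[OF d(1) f] anti'[OF d(2) f]
    by (simp add: XY circ_d_def succ_d_def prec_d_def Let_def dual_add
        dual_minus dual_rep'_eval bilinear_A' bilinear_RA' Lmul_eq Rmul_def[of _ _ f] c'
        sub_adjacent_def[of succA])
  then have "fst (succd X Y + precd X Y) = fst (circd X Y)"
    by (rule dual_separates)
  moreover have "snd (succd X Y + precd X Y) = snd (circd X Y)"
    using d an[OF d(2), of _ x] an[OF d(1), of _ y]
    by (simp add: XY sub_adjacent_def circ_d_def succ_d_def prec_d_def Let_def fun_eq_iff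
      dual_rep_def Lmul_eq Rmul_def dual_add dual_minus)
  ultimately show ?thesis unfolding sub_adjacent_def[of succd] by (rule prod_eqI)
qed

section \<open>The defect of the Leibniz identity as a scalar\<close>

lemmas leibniz_A = special_pre_leibniz_algebraD(5-7)[OF A, OF UNIV_I UNIV_I UNIV_I]
lemmas leibniz_A' = special_pre_leibniz_algebraD(5-7)[OF A']

lemma anticommute:
  "precA x y = - precA y x" "a \<in> dual s \<Longrightarrow> b \<in> dual s \<Longrightarrow> precA' a b = - precA' b a"
  using special_pre_leibniz_algebraD(4)[OF A, of x y] special_pre_leibniz_algebraD(4)[OF A', of a b]
  by simp_all

text \<open>This is the function \<open>F\<close> of the opening comment.\<close>

definition defect where
  "defect X Y Z W = form_d (circd X (circd Y Z) - circd (circd X Y) Z - circd Y (circd X Z)) W"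

text \<open>Left-invariance moves the outer factor of the first and third product across the form,
  and the adjoint relation treats the middle one. No threefold product is left, so on vectors and
  functionals only products of two such elements occur.\<close>

lemma defect_eq:
  assumes "X \<in> dsum s" "Y \<in> dsum s" "Z \<in> dsum s" "W \<in> dsum s"
  shows "defect X Y Z W = form_d (circd X Z) (circd Y W) - form_d (circd Y Z) (circd X W)
    + form_d (precd W Z) (circd X Y)"
proof -
  note cl = bilinear_multD(3)[OF bilinear_d(1)] bilinear_multD(3)[OF bilinear_d(3)]
  note B = nondeg_sym_formD[OF nondeg_sym_form_d]
  have li: "form_d (circd U V) T = - form_d V (circd U T)"
    if "U \<in> dsum s" "V \<in> dsum s" "T \<in> dsum s" for U V T
    using left_invariant_circ_d that by (simp add: left_invariant_def eq_neg_iff_add_eq_0)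
  have diff: "form_d (U - V) T = form_d U T - form_d V T"
    if "U \<in> dsum s" "V \<in> dsum s" "T \<in> dsum s" for U V T
    using that by (cases U; cases V; cases T) (simp add: dual_minus)
  have "form_d (precd W Z) (circd X Y) = - form_d (circd (circd X Y) Z) W"
    using assms by (simp add: form_prec_d_adjoint cl B(5)[of W])
  moreover have "form_d (circd X (circd Y Z)) W = - form_d (circd Y Z) (circd X W)"
    "form_d (circd Y (circd X Z)) W = - form_d (circd X Z) (circd Y W)"
    by (rule li; use assms cl in simp)+
  moreover have "defect X Y Z W = form_d (circd X (circd Y Z)) W
      - form_d (circd (circd X Y) Z) W - form_d (circd Y (circd X Z)) W"
    unfolding defect_def
    by (subst diff, (simp_all add: assms cl subspace_closed[OF vector_space_dscale subspace_dsum])[3])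
      (simp add: diff assms cl)
  ultimately show ?thesis by simp
qed

lemma leibniz_iff_defect:
  "leibniz_algebra (dscale s) (dsum s) circd \<longleftrightarrow>
    (\<forall>X\<in>dsum s. \<forall>Y\<in>dsum s. \<forall>Z\<in>dsum s. \<forall>W\<in>dsum s. defect X Y Z W = 0)"
proof -
  note cl = bilinear_multD(3)[OF bilinear_d(1)]
    subspace_closed(2,3)[OF vector_space_dscale subspace_dsum]
  have "circd X (circd Y Z) = circd (circd X Y) Z + circd Y (circd X Z) \<longleftrightarrow>
      (\<forall>W\<in>dsum s. defect X Y Z W = 0)" (is "?l = ?r \<longleftrightarrow> _")
    if "X \<in> dsum s" "Y \<in> dsum s" "Z \<in> dsum s" for X Y Z
  proof
    assume "?l = ?r"
    then have "circd X (circd Y Z) - circd (circd X Y) Z - circd Y (circd X Z) = (0, 0)"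
      by (simp add: zero_prod_def)
    then show "\<forall>W\<in>dsum s. defect X Y Z W = 0"
      unfolding defect_def by (auto simp: dsum_def dual_minus)
  next
    assume "\<forall>W\<in>dsum s. defect X Y Z W = 0"
    then have "circd X (circd Y Z) - circd (circd X Y) Z - circd Y (circd X Z) = 0"
      unfolding defect_def
      by (intro nondeg_sym_formD(6)[OF nondeg_sym_form_d]) (use that cl in auto)
    then show "?l = ?r" by (simp add: algebra_simps)
  qed
  then show ?thesis
    using bilinear_d(1) by (simp add: leibniz_algebra_def)
qed

text \<open>In \<open>defect_eq\<close> the exchange swaps the first two terms, which have opposite
  signs, by symmetry of the form; the third changes sign because \<open>precd\<close> is
  anticommutative.\<close>

lemma defect_swap:
  assumes "X \<in> dsum s" "Y \<in> dsum s" "Z \<in> dsum s" "W \<in> dsum s"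
  shows "defect X Y W Z = - defect X Y Z W"
proof -
  note cl = bilinear_multD(3)[OF bilinear_d(1)]
  have "form_d (precd W Z) T = - form_d (precd Z W) T" if "T \<in> dsum s" for T
    using assms(3,4) that anticommute(1)[of "fst W" "fst Z"] anticommute(2)[of "snd W" "snd Z"]
    by (cases W; cases Z; cases T) (simp add: form_prec_d dual_minus)
  moreover note nondeg_sym_formD(5)[OF nondeg_sym_form_d, of "circd X Z" "circd Y W"]
    nondeg_sym_formD(5)[OF nondeg_sym_form_d, of "circd Y Z" "circd X W"]
  ultimately show ?thesis
    using assms by (simp add: defect_eq cl)
qed

text \<open>Additivity in each slot reduces the Leibniz identity to arguments that are vectors or
  functionals.\<close>

lemma defect_split:
  assumes "(x, a) \<in> dsum s" "Y \<in> dsum s" "Z \<in> dsum s" "W \<in> dsum s"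
  shows "defect (x, a) Y Z W = defect (x, 0) Y Z W + defect (0, a) Y Z W"
    "defect Y (x, a) Z W = defect Y (x, 0) Z W + defect Y (0, a) Z W"
    "defect Y Z (x, a) W = defect Y Z (x, 0) W + defect Y Z (0, a) W"
    "defect Y Z W (x, a) = defect Y Z W (x, 0) + defect Y Z W (0, a)"
proof -
  note cl = bilinear_multD(3)[OF bilinear_d(1)] bilinear_multD(3)[OF bilinear_d(3)]
  note B = nondeg_sym_formD(1,2)[OF nondeg_sym_form_d]
  have d: "(x, 0) \<in> dsum s" "(0, a) \<in> dsum s" using assms by auto
  have eq: "(x, a) = (x, 0) + (0, a)" by simp
  note add = bilinear_multD(4,5)[OF bilinear_d(1)] bilinear_multD(4,5)[OF bilinear_d(3)]
  show "defect (x, a) Y Z W = defect (x, 0) Y Z W + defect (0, a) Y Z W"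
    "defect Y (x, a) Z W = defect Y (x, 0) Z W + defect Y (0, a) Z W"
    "defect Y Z (x, a) W = defect Y Z (x, 0) W + defect Y Z (0, a) W"
    "defect Y Z W (x, a) = defect Y Z W (x, 0) + defect Y Z W (0, a)"
    unfolding defect_eq[OF assms(1) assms(2-4)] defect_eq[OF assms(2) assms(1) assms(3,4)]
      defect_eq[OF assms(2,3,1,4)] defect_eq[OF assms(2-4,1)]
    unfolding eq using assms(2-4) d by (simp_all only: defect_eq add B cl) (simp_all only: algebra_simps)
qed

section \<open>Values of the defect on vectors and functionals\<close>

lemma dual_rep_eq: "dual_rep m x a = - (\<lambda>v. a (m x v))"
  by (simp add: dual_rep_def fun_eq_iff)

text \<open>The sign of a functional stands outside the abstraction, so that bilinearity can pull it
  out of a product in the dual space.\<close>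

lemma homogeneous_products:
  assumes "a \<in> dual s" "b \<in> dual s"
  shows "circd (x, 0) (y, 0) = (circA x y, 0)"
    "circd (x, 0) (0, b) = (- dual_rep' s precA' b x, - (\<lambda>v. b (circA x v)))"
    "circd (0, a) (y, 0) = (dual_rep' s circA' a y, \<lambda>v. a (precA y v))"
    "circd (0, a) (0, b) = (0, circA' a b)"
    "precd (x, 0) (y, 0) = (precA x y, 0)"
    "precd (x, 0) (0, b) = (dual_rep' s (Rmul circA') b x, \<lambda>v. b (circA v x))"
    "precd (0, a) (y, 0) = (- dual_rep' s (Rmul circA') a y, - (\<lambda>v. a (circA v y)))"
    "precd (0, a) (0, b) = (0, precA' a b)"
  using assms
  by (simp_all add: circ_d_def prec_d_def Let_def Lmul_eq dual_rep'_zero bilinear_A' bilinear_RA'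
    dual_rep_eq fun_eq_iff Rmul_def[of circA] dual_minus bilinear_A
    bilinear_mult_zero[of s UNIV] bilinear_mult_zero[of fscale "dual s"])

text \<open>The vector given by the dual action sits inside a product, so
  \<open>dual_rep'_eval\<close> is applied to \<open>f\<close> composed with multiplication by
  \<open>y\<close>.\<close>

lemma dual_rep'_eval_mult:
  assumes "bilinear_mult fscale (dual s) m" "a \<in> dual s" "f \<in> dual s"
  shows "f (circA (dual_rep' s m a x) y) = - m a (\<lambda>v. f (circA v y)) x"
    "f (circA y (dual_rep' s m a x)) = - m a (\<lambda>v. f (circA y v)) x"
    "f (precA (dual_rep' s m a x) y) = - m a (\<lambda>v. f (precA v y)) x"
    "f (precA y (dual_rep' s m a x)) = - m a (\<lambda>v. f (precA y v)) x"
  using dual_rep'_eval[OF assms(1,2) dual_mult_closed(1)[OF assms(3)]]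
    dual_rep'_eval[OF assms(1,2) dual_mult_closed(2)[OF assms(3)]]
    dual_rep'_eval[OF assms(1,2) dual_mult_closed(3)[OF assms(3)]]
    dual_rep'_eval[OF assms(1,2) dual_mult_closed(4)[OF assms(3)]]
  by simp_all

lemmas defect_simps = defect_eq homogeneous_products dual_rep'_eval dual_rep'_eval_mult
  bilinear_A' bilinear_RA' dual_minus dual_add Rmul_def A_closed
  bilinear_mult_uminus[OF bilinear_A'(2)] bilinear_mult_uminus[OF bilinear_A'(3)]
  bilinear_mult_uminus[OF bilinear_A(2) UNIV_I UNIV_I]
  bilinear_mult_uminus[OF bilinear_A(3) UNIV_I UNIV_I]
  bilinear_mult_zero[OF bilinear_A(2) UNIV_I] bilinear_mult_zero[OF bilinear_A(3) UNIV_I]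

text \<open>Here and in the next lemma, products nested on the left are expressed by products nested
  on the right, so that terms from different axioms become comparable.\<close>

lemma dual_leibniz_A:
  assumes "e \<in> dual s"
  shows "e (circA (circA x y) z) = e (circA x (circA y z)) - e (circA y (circA x z))"
    "e (precA (circA x y) z) = e (precA x (precA y z)) - e (precA y (circA x z))"
    "e (circA x (precA y z)) = e (precA x (precA y z))"
    "e (precA x y) = - e (precA y x)"
proof -
  have "e (circA x (circA y z)) = e (circA (circA x y) z + circA y (circA x z))"
    "e (circA x (precA y z)) = e (precA (circA x y) z + precA y (circA x z))"
    "e (circA x (precA y z)) = e (precA x (precA y z))"
    "e (precA x y) = e (- precA y x)"
    by (fact arg_cong[where f = e, OF leibniz_A(1)] arg_cong[where f = e, OF leibniz_A(2)]
        arg_cong[where f = e, OF leibniz_A(3)] arg_cong[where f = e, OF anticommute(1)])+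
  then show "e (circA (circA x y) z) = e (circA x (circA y z)) - e (circA y (circA x z))"
    "e (precA (circA x y) z) = e (precA x (precA y z)) - e (precA y (circA x z))"
    "e (circA x (precA y z)) = e (precA x (precA y z))"
    "e (precA x y) = - e (precA y x)"
    using dual_add[OF assms] dual_minus[OF assms] by (simp_all only: algebra_simps)
qed

lemma eval_leibniz_A':
  assumes "a \<in> dual s" "b \<in> dual s" "c \<in> dual s"
  shows "circA' (circA' a b) c v = circA' a (circA' b c) v - circA' b (circA' a c) v"
    "precA' (circA' a b) c v = precA' a (precA' b c) v - precA' b (circA' a c) v"
    "circA' a (precA' b c) v = precA' a (precA' b c) v"
  using fun_cong[OF leibniz_A'(1)[OF assms], of v] fun_cong[OF leibniz_A'(2)[OF assms], of v]
    fun_cong[OF leibniz_A'(3)[OF assms], of v]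
  by (simp_all only: plus_fun_apply algebra_simps)

text \<open>Vectors alone pair to zero. A functional in the last slot gives the Leibniz identity of
  \<open>A\<close> under \<open>e\<close>, in the second slot the derivation rule for
  \<open>precA\<close>, and in the first slot that rule combined with
  \<open>x \<circ> (y \<prec> z) = x \<prec> (y \<prec> z)\<close>. The third slot is left to
  \<open>defect_swap\<close>. The next lemma is the mirror image, with the two summands
  exchanged.\<close>

lemma defect_at_most_one_dual:
  assumes e: "e \<in> dual s"
  shows "defect (x, 0) (y, 0) (z, 0) (w, 0) = 0"
    "defect (x, 0) (y, 0) (z, 0) (0, e) = 0"
    "defect (x, 0) (0, e) (z, 0) (w, 0) = 0"
    "defect (0, e) (y, 0) (z, 0) (w, 0) = 0"
  using e dual_leibniz_A(1-3)[OF e, of x y z] dual_leibniz_A(1-3)[OF e, of x z w]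
    dual_leibniz_A(1-3)[OF e, of y z w] anticommute(1)[of w z] anticommute(1)[of w "circA x z"]
    anticommute(1)[of w "circA y z"]
  by (simp_all add: defect_simps)

lemma defect_at_most_one_primal:
  assumes "a \<in> dual s" "b \<in> dual s" "c \<in> dual s" "e \<in> dual s"
  shows "defect (0, a) (0, b) (0, c) (0, e) = 0"
    "defect (0, a) (0, b) (w, 0) (0, e) = 0"
    "defect (0, a) (x, 0) (0, c) (0, e) = 0"
    "defect (x, 0) (0, b) (0, c) (0, e) = 0"
  using assms anticommute(2)[of e c] anticommute(2)[of e "circA' a c"] anticommute(2)[of e "circA' b c"]
  by (simp_all add: defect_simps eval_leibniz_A')

text \<open>Composing a functional with a left or right multiplication is the effect of
  \<open>tensor_map\<close> with \<open>Lmul\<close> or \<open>Rmul\<close>, so these values can be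
  compared term by term with the bialgebra conditions.\<close>

lemma defect_balanced:
  assumes "a \<in> dual s" "b \<in> dual s"
  shows "defect (0, a) (0, b) (x, 0) (y, 0) =
      circA' a (\<lambda>v. b (precA x v)) y - circA' b (\<lambda>v. a (precA x v)) y
      + circA' a (\<lambda>v. b (precA v y)) x - circA' b (\<lambda>v. a (precA v y)) x - circA' a b (precA x y)"
    "defect (x, 0) (0, a) (y, 0) (0, b) =
      circA' a b (circA x y) - circA' a (\<lambda>v. b (circA x v)) y
      + precA' (\<lambda>v. a (precA y v)) b x - precA' a (\<lambda>v. b (circA v y)) x
      - circA' (\<lambda>v. a (circA x v)) b y"
    "defect (x, 0) (y, 0) (0, a) (0, b) =
      precA' a (\<lambda>v. b (circA x v)) y + precA' (\<lambda>v. a (circA x v)) b y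
      - (precA' a (\<lambda>v. b (circA y v)) x + precA' (\<lambda>v. a (circA y v)) b x)
      - precA' a b (circA x y)"
    "defect (0, a) (x, 0) (y, 0) (0, b) =
      circA' a (\<lambda>v. b (circA v y)) x + (circA' a (\<lambda>v. b (circA x v)) y
      + circA' (\<lambda>v. a (precA x v)) b y) - precA' (\<lambda>v. a (precA y v)) b x
      - circA' a b (circA x y)"
proof -
  \<comment> \<open>For \<open>precA\<close>, \<open>homogeneous_products\<close> yields functionals
    composed with left multiplications only, whereas the first bialgebra condition also has a right
    multiplication.\<close>
  have flip: "(\<lambda>v. f (precA v y)) = - (\<lambda>v. f (precA y v))" if "f \<in> dual s" for f
    using dual_leibniz_A(4)[OF that, of _ y] by (simp add: fun_eq_iff)
  show "defect (0, a) (0, b) (x, 0) (y, 0) =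
      circA' a (\<lambda>v. b (precA x v)) y - circA' b (\<lambda>v. a (precA x v)) y
      + circA' a (\<lambda>v. b (precA v y)) x - circA' b (\<lambda>v. a (precA v y)) x - circA' a b (precA x y)"
    using assms anticommute(1)[of y x] flip[of a] flip[of b] by (simp add: defect_simps)
qed (use assms anticommute(2)[of b a] anticommute(2)[of b "\<lambda>v. a (precA y v)"]
    anticommute(2)[of b "\<lambda>v. a (circA x v)"] anticommute(2)[of b "\<lambda>v. a (circA y v)"]
    in \<open>simp_all add: defect_simps\<close>)

text \<open>Splitting all four arguments leaves sixteen patterns. Ten have at most one argument from
  one of the summands and vanish; of the six balanced ones, four are listed and two follow from
  these by \<open>defect_swap\<close>.\<close>

lemma leibniz_iff_balanced:
  "leibniz_algebra (dscale s) (dsum s) circd \<longleftrightarrow>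
    (\<forall>x y. \<forall>a\<in>dual s. \<forall>b\<in>dual s.
      defect (0, a) (0, b) (x, 0) (y, 0) = 0 \<and> defect (x, 0) (0, a) (y, 0) (0, b) = 0 \<and>
      defect (x, 0) (y, 0) (0, a) (0, b) = 0 \<and> defect (0, a) (x, 0) (y, 0) (0, b) = 0)"
    (is "_ \<longleftrightarrow> ?R")
proof
  assume "leibniz_algebra (dscale s) (dsum s) circd"
  then show ?R by (simp add: leibniz_iff_defect)
next
  assume R: ?R
  \<comment> \<open>This covers the patterns with a functional in the third slot and a vector in the
    last.\<close>
  have swap: "defect X Y (0, a) (x, 0) = 0" if "defect X Y (x, 0) (0, a) = 0"
    "X \<in> dsum s" "Y \<in> dsum s" "a \<in> dual s" for X Y x a
    using defect_swap[of X Y "(x, 0)" "(0, a)"] that by simp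
  have "defect (x, a) (y, b) (z, c) (w, e) = 0"
    if "a \<in> dual s" "b \<in> dual s" "c \<in> dual s" "e \<in> dual s" for x a y b z c w e
    using that R
    by (simp add: defect_split(1)[of x a] defect_split(2)[of y b] defect_split(3)[of z c]
      defect_split(4)[of w e] swap defect_at_most_one_dual defect_at_most_one_primal)
  then show "leibniz_algebra (dscale s) (dsum s) circd"
    unfolding leibniz_iff_defect by (auto simp: dsum_def)
qed

section \<open>Linear duals, the coalgebra axioms and the bialgebra conditions\<close>

lemma linear_linear_dual:
  assumes "bilinear_mult fscale (dual s) m"
  shows "Vector_Spaces.linear s tscale (linear_dual s m)"
  unfolding Vector_Spaces.linear_iff
  using dual_add[OF bilinear_multD(3)[OF assms]] dual_scale[OF bilinear_multD(3)[OF assms]]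
  by (auto simp: vector_space_axioms vector_space_tscale linear_dual_def restrict2_def tscale_def
      fun_eq_iff)

lemma linear_dual_sum: "(\<lambda>x. linear_dual s succA' x + linear_dual s precA' x) = linear_dual s circA'"
  by (auto simp: linear_dual_def restrict2_def fun_eq_iff sub_adjacent_def)

lemma linear_dual_eval:
  "a \<in> dual s \<Longrightarrow> b \<in> dual s \<Longrightarrow> linear_dual s m x a b = m a b x"
  "a \<in> dual s \<Longrightarrow> b \<in> dual s \<Longrightarrow> (\<lambda>x. linear_dual s m x a b) = m a b"
  by (auto simp: linear_dual_def restrict2_def)

text \<open>Evaluated at functionals, each coalgebra axiom is an axiom of the dual algebra applied
  to \<open>x\<close>. The last one says that \<open>succA' a (precA' b c)\<close> vanishes, that
  is, \<open>circA'\<close> and \<open>precA'\<close> agree when the right factor is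
  \<open>precA' b c\<close>.\<close>

lemma coalgebra:
  "special_pre_leibniz_coalgebra s (linear_dual s succA') (linear_dual s precA')"
proof -
  have cl: "circA' a b \<in> dual s" "precA' a b \<in> dual s" "succA' a b \<in> dual s"
    if "a \<in> dual s" "b \<in> dual s" for a b
    using that by (simp_all add: A_closed)
  have "linear_dual s precA' x = - flip (linear_dual s precA' x)" for x
  proof (intro ext)
    fix a b
    show "linear_dual s precA' x a b = (- flip (linear_dual s precA' x)) a b"
      using anticommute(2)[of a b] by (simp add: linear_dual_def restrict2_def flip_def)
  qed
  moreover have "comul_id s (linear_dual s circA') (linear_dual s circA' x)
      + flip_id (id_comul s (linear_dual s circA') (linear_dual s circA' x))
      - id_comul s (linear_dual s circA') (linear_dual s circA' x) = 0" for x
    by (auto simp: comul_id_def id_comul_def flip_id_def restrict3_def linear_dual_eval cl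
        eval_leibniz_A' fun_eq_iff)
  moreover have "id_comul s (linear_dual s precA') (linear_dual s circA' x)
      = comul_id s (linear_dual s circA') (linear_dual s precA' x)
        + flip_id (id_comul s (linear_dual s circA') (linear_dual s precA' x))" for x
    by (auto simp: comul_id_def id_comul_def flip_id_def restrict3_def linear_dual_eval cl
        eval_leibniz_A' fun_eq_iff)
  moreover have "id_comul s (linear_dual s precA') (linear_dual s succA' x) = 0" for x
  proof -
    have "succA' a (precA' b c) x = 0" if "a \<in> dual s" "b \<in> dual s" "c \<in> dual s" for a b c
      using eval_leibniz_A'(3)[OF that, of x] by (simp add: sub_adjacent_def)
    then show ?thesis
      by (auto simp: id_comul_def restrict3_def linear_dual_eval cl fun_eq_iff)
  qed
  ultimately show ?thesis
    unfolding special_pre_leibniz_coalgebra_def Let_def linear_dual_sum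
    using linear_linear_dual bilinear_A' linear_dual_in_tensor_space by blast
qed

lemma bialgebra_iff_leibniz:
  "special_pre_leibniz_bialgebra s succA precA (linear_dual s succA') (linear_dual s precA')
    \<longleftrightarrow> leibniz_algebra (dscale s) (dsum s) circd"
proof -
  let ?D = "dual s"
  \<comment> \<open>\<open>restrict2\<close> makes both sides zero outside the dual space, so
    equality of tensors is tested only on pairs of functionals.\<close>
  note tensor_simps = tensor_map_def restrict2_def linear_dual_def flip_def fun_eq_iff o_def id_def
    Lmul_def Rmul_def
  have 1: "linear_dual s circA' (precA x y) =
      tensor_map s id (Lmul precA x) (linear_dual s circA' y)
        - flip (tensor_map s id (Lmul precA x) (linear_dual s circA' y))
      + (tensor_map s id (Rmul precA y) (linear_dual s circA' x)
        - flip (tensor_map s id (Rmul precA y) (linear_dual s circA' x)))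
    \<longleftrightarrow> (\<forall>a\<in>?D. \<forall>b\<in>?D. defect (0, a) (0, b) (x, 0) (y, 0) = 0)" for x y
    by (auto simp: tensor_simps defect_balanced algebra_simps)
  \<comment> \<open>In this sum the terms at \<open>circA x y\<close> cancel, which matches a
    condition without the coproduct of a product. Since 4 makes the second summand zero, 2 and 4
    together say that both summands vanish.\<close>
  have 2: "tensor_map s (Lmul circA x) id (linear_dual s circA' y) =
      tensor_map s (Lmul precA x) id (linear_dual s circA' y)
      + tensor_map s id (Rmul circA y) (linear_dual s circA' x)
      - tensor_map s id (Rmul circA y) (linear_dual s precA' x)
    \<longleftrightarrow> (\<forall>a\<in>?D. \<forall>b\<in>?D.
      defect (x, 0) (0, a) (y, 0) (0, b) + defect (0, a) (x, 0) (y, 0) (0, b) = 0)" for x y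
    by (auto simp: tensor_simps defect_balanced algebra_simps)
  have 3: "linear_dual s precA' (circA x y) =
      tensor_map s id (Lmul circA x) (linear_dual s precA' y)
        + tensor_map s (Lmul circA x) id (linear_dual s precA' y)
      - (tensor_map s id (Lmul circA y) (linear_dual s precA' x)
        + tensor_map s (Lmul circA y) id (linear_dual s precA' x))
    \<longleftrightarrow> (\<forall>a\<in>?D. \<forall>b\<in>?D. defect (x, 0) (y, 0) (0, a) (0, b) = 0)" for x y
    by (auto simp: tensor_simps defect_balanced algebra_simps)
  have 4: "linear_dual s circA' (circA x y) =
      tensor_map s id (Rmul circA y) (linear_dual s circA' x)
      + (tensor_map s id (Lmul circA x) (linear_dual s circA' y)
        + tensor_map s (Lmul precA x) id (linear_dual s circA' y))
      - tensor_map s (Lmul precA y) id (linear_dual s precA' x)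
    \<longleftrightarrow> (\<forall>a\<in>?D. \<forall>b\<in>?D. defect (0, a) (x, 0) (y, 0) (0, b) = 0)" for x y
    by (auto simp: tensor_simps defect_balanced algebra_simps)
  show ?thesis
    unfolding special_pre_leibniz_bialgebra_def Let_def fun_cong[OF linear_dual_sum]
      leibniz_iff_balanced 1 2 3 4
    using A coalgebra by (auto; metis add_0 add_0_right)
qed

section \<open>The explicit pre-Leibniz structure and uniqueness of the multiplication\<close>

lemma special_pre_leibniz_d_iff:
  "special_pre_leibniz_algebra (dscale s) (dsum s) succd precd
    \<longleftrightarrow> leibniz_algebra (dscale s) (dsum s) circd"
proof
  assume "special_pre_leibniz_algebra (dscale s) (dsum s) succd precd"
  then have "leibniz_algebra (dscale s) (dsum s) (sub_adjacent succd precd)"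
    by (simp add: special_pre_leibniz_algebra_def Let_def)
  then show "leibniz_algebra (dscale s) (dsum s) circd"
    by (rule leibniz_algebra_cong[rotated]) (rule sub_adjacent_d)
next
  assume "leibniz_algebra (dscale s) (dsum s) circd"
  then show "special_pre_leibniz_algebra (dscale s) (dsum s) succd precd"
  proof (rule special_pre_leibniz_algebra_of_form)
    show "sub_adjacent succd precd X Y = circd X Y" if "X \<in> dsum s" "Y \<in> dsum s" for X Y
      using that by (rule sub_adjacent_d)
    show "form_d (precd X Y) Z = - form_d X (circd Z Y)"
      if "X \<in> dsum s" "Y \<in> dsum s" "Z \<in> dsum s" for X Y Z
      using that by (rule form_prec_d_adjoint)
  qed (fact nondeg_sym_form_d left_invariant_circ_d bilinear_d)+
qed

lemma contains_d:
  "contains_A circd circA" "contains_A precd precA" "contains_A succd succA"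
  "contains_dual s circd circA'" "contains_dual s precd precA'" "contains_dual s succd succA'"
proof -
  note h = homogeneous_products
  \<comment> \<open>The products in \<open>succd\<close> are read off as differences, from those of
    \<open>circd\<close> and \<open>precd\<close>.\<close>
  have s: "succd X Y = circd X Y - precd X Y" if "X \<in> dsum s" "Y \<in> dsum s" for X Y
    using sub_adjacent_d[OF that] by (simp add: sub_adjacent_def algebra_simps)
  show "contains_A circd circA" "contains_A precd precA" "contains_A succd succA"
    using h(1,5)[of 0 0] by (simp_all add: contains_A_def s sub_adjacent_def)
  show "contains_dual s circd circA'" "contains_dual s precd precA'" "contains_dual s succd succA'"
    using h(4,8) by (simp_all add: contains_dual_def s sub_adjacent_def)
qed

text \<open>A product is determined by its pairings with vectors and with functionals. Products
  within one summand are prescribed; for a mixed product, left-invariance or \<open>adj\<close>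
  moves each pairing onto a product within one summand. In (b), \<open>q\<close> is the induced
  \<open>\<prec>\<close>, and in (c) the given one.\<close>

lemma circ_d_unique:
  assumes c: "bilinear_mult (dscale s) (dsum s) c" and li: "left_invariant (dsum s) c form_d"
    and cA: "contains_A c circA" "contains_dual s c circA'"
    and qA: "contains_A q precA" "contains_dual s q precA'"
    and adj: "\<And>X Y Z. X \<in> dsum s \<Longrightarrow> Y \<in> dsum s \<Longrightarrow> Z \<in> dsum s \<Longrightarrow>
      form_d (q X Y) Z = - form_d X (c Z Y)"
    and XY: "X \<in> dsum s" "Y \<in> dsum s"
  shows "c X Y = circd X Y"
proof -
  note cl = bilinear_multD(3)[OF c] bilinear_multD(3)[OF bilinear_d(1)]
  have sym: "form_d U V = form_d V U" if "U \<in> dsum s" "V \<in> dsum s" for U V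
    using nondeg_sym_formD(5)[OF nondeg_sym_form_d that] .
  have inv: "form_d (c U V) T = - form_d V (c U T)"
    if "U \<in> dsum s" "V \<in> dsum s" "T \<in> dsum s" for U V T
    using li that by (simp add: left_invariant_def eq_neg_iff_add_eq_0)
  have adj': "form_d (c U V) T = - form_d (q T V) U"
    if "U \<in> dsum s" "V \<in> dsum s" "T \<in> dsum s" for U V T
    using adj[OF that(3,2,1)] sym[OF cl(1)[OF that(1,2)] that(3)] by simp
  have eqI: "U = V" if "U \<in> dsum s" "V \<in> dsum s" "\<And>z. form_d U (z, 0) = form_d V (z, 0)"
    "\<And>e. e \<in> dual s \<Longrightarrow> form_d U (0, e) = form_d V (0, e)" for U V
  proof (rule form_d_eqI[OF that(1,2)])
    fix Z assume "Z \<in> dsum s"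
    then obtain z e where Z: "Z = (z, 0) + (0, e)" "e \<in> dual s" by (auto simp: dsum_def)
    show "form_d U Z = form_d V Z"
      unfolding Z(1) using that(3)[of z] that(4)[OF Z(2)] Z(2)
      by (simp only: nondeg_sym_formD(2)[OF nondeg_sym_form_d] that(1,2) mem_dsum dual_closed)
  qed
  note A_eq = cA(1)[unfolded contains_A_def, rule_format] qA(1)[unfolded contains_A_def, rule_format]
  note A'_eq = cA(2)[unfolded contains_dual_def, rule_format]
    qA(2)[unfolded contains_dual_def, rule_format]
  \<comment> \<open>Paired with a vector, left-invariance leaves a product of two vectors; paired
    with a functional, \<open>adj'\<close> leaves the \<open>q\<close>-product of two
    functionals.\<close>
  have AD: "c (x, 0) (0, b) = circd (x, 0) (0, b)" if "b \<in> dual s" for x b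
  proof (rule eqI)
    show "form_d (c (x, 0) (0, b)) (z, 0) = form_d (circd (x, 0) (0, b)) (z, 0)" for z
      using that by (simp add: inv form_circ_d A_eq dual_minus bilinear_mult_zero[OF bilinear_A'(2)]
        bilinear_mult_zero[OF bilinear_A'(3)])
    show "form_d (c (x, 0) (0, b)) (0, e) = form_d (circd (x, 0) (0, b)) (0, e)"
      if e: "e \<in> dual s" for e
      using that \<open>b \<in> dual s\<close> anticommute(2)[OF e \<open>b \<in> dual s\<close>]
      by (simp add: adj' form_circ_d A'_eq dual_minus bilinear_mult_zero[OF bilinear_A'(2)]
        bilinear_mult_zero[OF bilinear_A'(3)] bilinear_mult_zero[OF bilinear_A(3) UNIV_I])
  qed (use that cl in simp_all)
  \<comment> \<open>With the functional on the left, \<open>adj'\<close> serves for vectors and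
    left-invariance for functionals.\<close>
  have DA: "c (0, a) (y, 0) = circd (0, a) (y, 0)" if "a \<in> dual s" for y a
  proof (rule eqI)
    show "form_d (c (0, a) (y, 0)) (z, 0) = form_d (circd (0, a) (y, 0)) (z, 0)" for z
      using that anticommute(1)[of z y]
      by (simp add: adj' form_circ_d A_eq dual_minus bilinear_mult_zero[OF bilinear_A'(2)]
        bilinear_mult_zero[OF bilinear_A'(3)])
    show "form_d (c (0, a) (y, 0)) (0, e) = form_d (circd (0, a) (y, 0)) (0, e)"
      if e: "e \<in> dual s" for e
      using that \<open>a \<in> dual s\<close>
      by (simp add: inv form_circ_d A'_eq dual_minus bilinear_mult_zero[OF bilinear_A'(2)]
        bilinear_mult_zero[OF bilinear_A'(3)] bilinear_mult_zero[OF bilinear_A(3) UNIV_I]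
        bilinear_mult_zero[OF bilinear_A(2) UNIV_I])
  qed (use that cl in simp_all)
  obtain x a y b where X: "X = (x, 0) + (0, a)" and Y: "Y = (y, 0) + (0, b)"
    and d: "a \<in> dual s" "b \<in> dual s" using XY by (auto simp: dsum_def)
  have m: "(x, 0) \<in> dsum s" "(y, 0) \<in> dsum s" "(0, a) \<in> dsum s" "(0, b) \<in> dsum s"
    using d by simp_all
  have m': "(x, 0) + (0, a) \<in> dsum s" "(y, 0) + (0, b) \<in> dsum s"
    using d by simp_all
  show ?thesis
    unfolding X Y
    by (simp only: bilinear_multD(4,5)[OF c] bilinear_multD(4,5)[OF bilinear_d(1)] m m' AD[OF d(2)]
        DA[OF d(1)] A_eq A'_eq[OF d] homogeneous_products(1)[OF d] homogeneous_products(4)[OF d])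
qed

section \<open>Induced multiplications and Manin triples\<close>

lemma induced_prec_eq:
  assumes "W \<in> dsum s" "\<And>Z. Z \<in> dsum s \<Longrightarrow> form_d W Z = - form_d X (c Z Y)"
  shows "induced_prec (dsum s) form_d c X Y = W"
  unfolding induced_prec_def
proof (rule the_equality)
  fix V assume "V \<in> dsum s \<and> (\<forall>Z\<in>dsum s. form_d V Z = - form_d X (c Z Y))"
  then show "V = W" by (intro form_d_eqI) (simp_all add: assms)
qed (simp add: assms)

lemma induced_succ_eq:
  assumes "W \<in> dsum s" "\<And>Z. Z \<in> dsum s \<Longrightarrow> form_d W Z = - form_d Y (c X Z + c Z X)"
  shows "induced_succ (dsum s) form_d c X Y = W"
  unfolding induced_succ_def
proof (rule the_equality)
  fix V assume "V \<in> dsum s \<and> (\<forall>Z\<in>dsum s. form_d V Z = - form_d Y (c X Z + c Z X))"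
  then show "V = W" by (intro form_d_eqI) (simp_all add: assms)
qed (simp add: assms)

text \<open>The definite description denotes an element: \<open>form_d_represents\<close> gives
  existence, and nondegeneracy gives uniqueness. For an arbitrary \<open>c\<close> as in (b), this
  is the hypothesis \<open>adj\<close> of \<open>circ_d_unique\<close>.\<close>

lemma form_induced_prec:
  assumes c: "bilinear_mult (dscale s) (dsum s) c"
    and X: "X \<in> dsum s" and Y: "Y \<in> dsum s" and Z: "Z \<in> dsum s"
  shows "form_d (induced_prec (dsum s) form_d c X Y) Z = - form_d X (c Z Y)"
proof -
  note B = nondeg_sym_formD[OF nondeg_sym_form_d]
  have "\<exists>W\<in>dsum s. \<forall>Z\<in>dsum s. form_d W Z = - form_d X (c Z Y)"
    by (rule form_d_represents)
      (simp_all add: bilinear_multD(3,4,6)[OF c] B(2,4) X Y)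
  then obtain W where W: "W \<in> dsum s" "\<And>Z. Z \<in> dsum s \<Longrightarrow> form_d W Z = - form_d X (c Z Y)"
    by blast
  then show ?thesis using induced_prec_eq[where W = W and X = X and Y = Y and c = c] Z by simp
qed

lemma induced_d:
  assumes X: "X \<in> dsum s" and Y: "Y \<in> dsum s"
  shows "induced_prec (dsum s) form_d circd X Y = precd X Y"
    "induced_succ (dsum s) form_d circd X Y = succd X Y"
proof -
  note cl = bilinear_multD(3)[OF bilinear_d(1)] bilinear_multD(3)[OF bilinear_d(2)]
    bilinear_multD(3)[OF bilinear_d(3)]
  note B = nondeg_sym_formD[OF nondeg_sym_form_d]
  show "induced_prec (dsum s) form_d circd X Y = precd X Y"
    by (rule induced_prec_eq) (simp_all add: form_prec_d_adjoint cl X Y)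
  show "induced_succ (dsum s) form_d circd X Y = succd X Y"
  proof (rule induced_succ_eq)
    fix Z assume Z: "Z \<in> dsum s"
    have li: "form_d (circd U V) T = - form_d V (circd U T)"
      if "U \<in> dsum s" "V \<in> dsum s" "T \<in> dsum s" for U V T
      using left_invariant_circ_d that by (simp add: left_invariant_def eq_neg_iff_add_eq_0)
    have "form_d (succd X Y) Z + form_d (precd X Y) Z = form_d (circd X Y) Z"
      using sub_adjacent_d[OF X Y] B(1)[OF cl(2)[OF X Y] cl(3)[OF X Y] Z]
      by (simp add: sub_adjacent_def)
    \<comment> \<open>The adjoint relation followed by left-invariance; subtracting this from the
      pairing of \<open>circd X Y\<close> leaves the defining formula of the induced
      \<open>\<succ>\<close>.\<close>
    moreover have "form_d (precd X Y) Z = form_d Y (circd Z X)"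
      using B(5)[OF X cl(1)[OF Z Y]] li[OF Z Y X] by (simp add: form_prec_d_adjoint X Y Z)
    ultimately show "form_d (succd X Y) Z = - form_d Y (circd X Z + circd Z X)"
      using li[OF X Y Z] by (simp add: B(2) cl X Y Z eq_diff_eq)
  qed (simp add: cl X Y)
qed

lemma manin_triple_leibniz_iff:
  "(\<exists>c. manin_triple_leibniz s c circA circA' \<and>
      (let sd = induced_succ (dsum s) form_d c; pd = induced_prec (dsum s) form_d c
       in compatible_on (dscale s) (dsum s) c sd pd \<and>
          contains_A sd succA \<and> contains_A pd precA \<and>
          contains_dual s sd succA' \<and> contains_dual s pd precA'))
    \<longleftrightarrow> leibniz_algebra (dscale s) (dsum s) circd" (is "(\<exists>c. ?M c) \<longleftrightarrow> ?L")
proof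
  assume "\<exists>c. ?M c"
  then obtain c where M: "?M c" by blast
  then have l: "leibniz_algebra (dscale s) (dsum s) c"
    and c: "left_invariant (dsum s) c form_d" "contains_A c circA" "contains_dual s c circA'"
    "contains_A (induced_prec (dsum s) form_d c) precA"
    "contains_dual s (induced_prec (dsum s) form_d c) precA'"
    by (simp_all add: manin_triple_leibniz_def Let_def)
  then have b: "bilinear_mult (dscale s) (dsum s) c" by (simp add: leibniz_algebra_def)
  show ?L
  proof (rule leibniz_algebra_cong[OF _ l])
    fix X Y assume XY: "X \<in> dsum s" "Y \<in> dsum s"
    show "c X Y = circd X Y" by (rule circ_d_unique[OF b c _ XY]) (rule form_induced_prec[OF b])
  qed
next
  assume L: ?L
  then have S: "special_pre_leibniz_algebra (dscale s) (dsum s) succd precd"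
    by (simp add: special_pre_leibniz_d_iff)
  have "leibniz_algebra s UNIV circA" "leibniz_algebra fscale (dual s) circA'"
    using A A' by (simp_all add: special_pre_leibniz_algebra_def Let_def)
  then have "manin_triple_leibniz s circd circA circA'"
    using L contains_d nondeg_sym_form_d left_invariant_circ_d
    by (simp add: manin_triple_leibniz_def)
  \<comment> \<open>The induced multiplications are known to equal \<open>succd\<close> and
    \<open>precd\<close> only on \<open>dsum s\<close>, hence the congruence rule.\<close>
  moreover have "special_pre_leibniz_algebra (dscale s) (dsum s)
      (induced_succ (dsum s) form_d circd) (induced_prec (dsum s) form_d circd)"
    by (rule special_pre_leibniz_algebra_cong[OF _ _ S]) (simp_all add: induced_d)
  then have "compatible_on (dscale s) (dsum s) circd
      (induced_succ (dsum s) form_d circd) (induced_prec (dsum s) form_d circd)"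
    using sub_adjacent_d by (simp add: compatible_on_def sub_adjacent_def induced_d)
  moreover have "contains_A (induced_succ (dsum s) form_d circd) succA"
    "contains_A (induced_prec (dsum s) form_d circd) precA"
    "contains_dual s (induced_succ (dsum s) form_d circd) succA'"
    "contains_dual s (induced_prec (dsum s) form_d circd) precA'"
    using contains_d by (simp_all add: contains_A_def contains_dual_def induced_d)
  ultimately have "?M circd" by (simp add: Let_def)
  then show "\<exists>c. ?M c" by blast
qed

lemma manin_triple_special_pre_leibniz_iff:
  "(\<exists>sd pd. manin_triple_special_pre_leibniz s sd pd succA precA succA' precA')
    \<longleftrightarrow> leibniz_algebra (dscale s) (dsum s) circd" (is "?M \<longleftrightarrow> ?L")
proof
  assume ?M
  then obtain sd pd where S: "special_pre_leibniz_algebra (dscale s) (dsum s) sd pd"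
    and adj: "\<And>X Y Z. X \<in> dsum s \<Longrightarrow> Y \<in> dsum s \<Longrightarrow> Z \<in> dsum s \<Longrightarrow>
      form_d (pd X Y) Z = - form_d X (sub_adjacent sd pd Z Y)"
    and sA: "contains_A sd succA" "contains_dual s sd succA'"
    and pA: "contains_A pd precA" "contains_dual s pd precA'"
    unfolding manin_triple_special_pre_leibniz_def quadratic_special_pre_leibniz_algebra_def by blast
  let ?c = "sub_adjacent sd pd"
  note c = special_pre_leibniz_algebraD(3)[OF S]
  \<comment> \<open>A quadratic structure has left-invariance only implicitly: the invariance
    condition is used twice, with anticommutativity of \<open>pd\<close> in between.\<close>
  have li: "left_invariant (dsum s) ?c form_d"
    unfolding left_invariant_def
  proof (intro ballI)
    fix X Y Z assume XYZ: "X \<in> dsum s" "Y \<in> dsum s" "Z \<in> dsum s"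
    have "form_d (?c X Y) Z = form_d Z (?c X Y)"
      by (rule nondeg_sym_formD(5)[OF nondeg_sym_form_d bilinear_multD(3)[OF c XYZ(1,2)] XYZ(3)])
    also have "\<dots> = - form_d (pd Z Y) X" by (simp add: adj XYZ)
    also have "\<dots> = form_d (pd Y Z) X"
      using special_pre_leibniz_algebraD(4)[OF S XYZ(3,2)]
        sym_form_uminus(1)[OF vector_space_dscale nondeg_sym_form_d
          bilinear_multD(3)[OF special_pre_leibniz_algebraD(2)[OF S] XYZ(2,3)] XYZ(1)] by simp
    also have "\<dots> = - form_d Y (?c X Z)" by (rule adj[OF XYZ(2,3,1)])
    finally show "form_d (?c X Y) Z + form_d Y (?c X Z) = 0" by simp
  qed
  have cA: "contains_A ?c circA" "contains_dual s ?c circA'"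
    using sA pA by (simp_all add: contains_A_def contains_dual_def sub_adjacent_def)
  have l: "leibniz_algebra (dscale s) (dsum s) ?c"
    using S by (simp add: special_pre_leibniz_algebra_def Let_def)
  show ?L
  proof (rule leibniz_algebra_cong[OF _ l])
    fix X Y assume XY: "X \<in> dsum s" "Y \<in> dsum s"
    show "?c X Y = circd X Y" by (rule circ_d_unique[OF c li cA pA _ XY]) (rule adj)
  qed
next
  assume ?L
  then have "special_pre_leibniz_algebra (dscale s) (dsum s) succd precd"
    by (simp add: special_pre_leibniz_d_iff)
  moreover have "form_d (precd X Y) Z = - form_d X (sub_adjacent succd precd Z Y)"
    if "X \<in> dsum s" "Y \<in> dsum s" "Z \<in> dsum s" for X Y Z
    using that by (simp add: form_prec_d_adjoint sub_adjacent_d)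
  ultimately have
    "quadratic_special_pre_leibniz_algebra (dscale s) (dsum s) succd precd form_d"
    unfolding quadratic_special_pre_leibniz_algebra_def
    by (intro conjI ballI nondeg_sym_form_d)
  then have "manin_triple_special_pre_leibniz s succd precd succA precA succA' precA'"
    unfolding manin_triple_special_pre_leibniz_def by (intro conjI A A' contains_d)
  then show ?M by blast
qed

end

theorem theorem4p8:
  fixes s :: "'k::{alg_closed_field, field_char_0} \<Rightarrow> 'a::ab_group_add \<Rightarrow> 'a"
    and Basis :: "'a set"
    and succA precA :: "'a \<Rightarrow> 'a \<Rightarrow> 'a"
    and succA' precA' :: "('a \<Rightarrow> 'k) \<Rightarrow> ('a \<Rightarrow> 'k) \<Rightarrow> ('a \<Rightarrow> 'k)"
  assumes "finite_dimensional_vector_space s Basis"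
    and "special_pre_leibniz_algebra s UNIV succA precA"
    and "special_pre_leibniz_algebra fscale (dual s) succA' precA'"
  shows
   "let cond_a =
          special_pre_leibniz_bialgebra s succA precA
            (linear_dual s succA') (linear_dual s precA');
        cond_b =
          (\<exists>circd.
             manin_triple_leibniz s circd (sub_adjacent succA precA) (sub_adjacent succA' precA') \<and>
             (let succd = induced_succ (dsum s) form_d circd;
                  precd = induced_prec (dsum s) form_d circd
              in compatible_on (dscale s) (dsum s) circd succd precd \<and>
                 contains_A succd succA \<and> contains_A precd precA \<and>
                 contains_dual s succd succA' \<and> contains_dual s precd precA'));
        cond_c =
          (\<exists>succd precd.
             manin_triple_special_pre_leibniz s succd precd succA precA succA' precA');
        cond_d =
          leibniz_algebra (dscale s) (dsum s) (circ_d s succA precA succA' precA');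
        cond_e =
          special_pre_leibniz_algebra (dscale s) (dsum s)
            (succ_d s succA succA') (prec_d s succA precA succA' precA')
    in (cond_a \<longleftrightarrow> cond_b) \<and> (cond_a \<longleftrightarrow> cond_c) \<and>
       (cond_a \<longleftrightarrow> cond_d) \<and> (cond_a \<longleftrightarrow> cond_e)"
proof -
  interpret pre_leibniz_pair s Basis succA precA succA' precA'
    using assms by (simp add: pre_leibniz_pair_def pre_leibniz_pair_axioms_def)
  show ?thesis
    \<comment> \<open>Each rewrite turns one of the other conditions into (d).\<close>
    unfolding Let_def manin_triple_leibniz_iff[unfolded Let_def] bialgebra_iff_leibniz
      manin_triple_special_pre_leibniz_iff special_pre_leibniz_d_iff
    by simp
qed

end
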